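(* Let $\tau$ be a primitive Dirichlet character with modulus $q>1$. Suppose $s=\sigma+it$ with $\sigma,t$ real and $\sigma<0$. Then $$|L(s,\tau)|\le \zeta(1-\sigma)\left(\frac{q}{2\pi}\right)^{\frac12-\sigma}\cdot\big|s-[\sigma]+1\big|^{\frac12-\sigma+[\sigma]}\cdot\prod_{j=1}^{-[\sigma]}|s+j-1| .$$
   Context: $L(s,\tau)$ is the Dirichlet $L$-function of $\tau$ (analytically continued to $\mathbb C$). For a real number $x$, $[x]$ denotes the integer closest to $x$, choosing the one closer to $0$ if two integers are equally close to $x$. An empty product equals $1$. *)

theory Defs
  imports "HOL-Complex_Analysis.Complex_Analysis"
begin

definition dirichlet_character :: "nat \<Rightarrow> (int \<Rightarrow> complex) \<Rightarrow> bool" where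
  "dirichlet_character q \<tau> \<longleftrightarrow>
     q > 0 \<and>
     (\<forall>a b. \<tau> (a * b) = \<tau> a * \<tau> b) \<and>
     (\<forall>a. \<tau> (a + int q) = \<tau> a) \<and>
     (\<forall>a. \<tau> a \<noteq> 0 \<longleftrightarrow> coprime a (int q))"

definition induced_by :: "nat \<Rightarrow> (int \<Rightarrow> complex) \<Rightarrow> nat \<Rightarrow> (int \<Rightarrow> complex) \<Rightarrow> bool" where
  "induced_by q \<tau> d \<psi> \<longleftrightarrow>
     d dvd q \<and> dirichlet_character d \<psi> \<and> (\<forall>a. coprime a (int q) \<longrightarrow> \<tau> a = \<psi> a)"

definition primitive_dirichlet_character :: "nat \<Rightarrow> (int \<Rightarrow> complex) \<Rightarrow> bool" where
  "primitive_dirichlet_character q \<tau> \<longleftrightarrow>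
     dirichlet_character q \<tau> \<and> (\<forall>d \<psi>. induced_by q \<tau> d \<psi> \<longrightarrow> d = q)"

definition dirichlet_series :: "(int \<Rightarrow> complex) \<Rightarrow> complex \<Rightarrow> complex" where
  "dirichlet_series \<tau> s = (\<Sum>n. \<tau> (int (Suc n)) / of_nat (Suc n) powr s)"

text \<open>
  Meromorphic rather than entire, so that the definition also covers principal characters,
  whose \<open>L\<close>-functions have a pole at 1 (where \<^const>\<open>nicely_meromorphic_on\<close>
  fixes the value 0). Such a continuation is unique; see \<open>L_continuation_unique\<close> below.
\<close>

definition is_L_continuation :: "(int \<Rightarrow> complex) \<Rightarrow> (complex \<Rightarrow> complex) \<Rightarrow> bool" where
  "is_L_continuation \<tau> f \<longleftrightarrow>
     f nicely_meromorphic_on UNIV \<and> (\<forall>s. Re s > 1 \<longrightarrow> f s = dirichlet_series \<tau> s)"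

definition dirichlet_L :: "(int \<Rightarrow> complex) \<Rightarrow> complex \<Rightarrow> complex" where
  "dirichlet_L \<tau> = (THE f. is_L_continuation \<tau> f)"

text \<open>The Riemann zeta function on the real half-line \<open>x > 1\<close> only.\<close>

definition zeta_real :: "real \<Rightarrow> real" where
  "zeta_real x = (\<Sum>n. 1 / real (Suc n) powr x)"

text \<open>
  Ties go towards 0, unlike \<^const>\<open>round\<close>, which rounds them upwards.
\<close>

definition nearest_int :: "real \<Rightarrow> int" where
  "nearest_int x = (THE n. \<forall>m. m \<noteq> n \<longrightarrow>
     \<bar>x - of_int n\<bar> < \<bar>x - of_int m\<bar> \<or>
     (\<bar>x - of_int n\<bar> = \<bar>x - of_int m\<bar> \<and> \<bar>n\<bar> < \<bar>m\<bar>))"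

lemma nearest_int_eq:
  "nearest_int x = (if x \<ge> 0 then \<lceil>x - 1/2\<rceil> else \<lfloor>x + 1/2\<rfloor>)"
  unfolding nearest_int_def
proof (rule the_equality)
  let ?n = "if x \<ge> 0 then \<lceil>x - 1/2\<rceil> else \<lfloor>x + 1/2\<rfloor>"
  show *: "\<forall>m. m \<noteq> ?n \<longrightarrow>
     \<bar>x - of_int ?n\<bar> < \<bar>x - of_int m\<bar> \<or>
     (\<bar>x - of_int ?n\<bar> = \<bar>x - of_int m\<bar> \<and> \<bar>?n\<bar> < \<bar>m\<bar>)"
  proof (intro allI impI)
    fix m assume "m \<noteq> ?n"
    then consider "m \<ge> ?n + 1" | "m \<le> ?n - 1" by linarith
    then show "\<bar>x - of_int ?n\<bar> < \<bar>x - of_int m\<bar> \<or>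
     (\<bar>x - of_int ?n\<bar> = \<bar>x - of_int m\<bar> \<and> \<bar>?n\<bar> < \<bar>m\<bar>)"
    proof cases
      case 1
      then have "real_of_int m \<ge> real_of_int ?n + 1" by linarith
      with 1 show ?thesis by (cases "x \<ge> 0"; simp only: if_True if_False; linarith)
    next
      case 2
      then have "real_of_int m \<le> real_of_int ?n - 1" by linarith
      with 2 show ?thesis by (cases "x \<ge> 0"; simp only: if_True if_False; linarith)
    qed
  qed
  fix n assume n: "\<forall>m. m \<noteq> n \<longrightarrow>
     \<bar>x - of_int n\<bar> < \<bar>x - of_int m\<bar> \<or>
     (\<bar>x - of_int n\<bar> = \<bar>x - of_int m\<bar> \<and> \<bar>n\<bar> < \<bar>m\<bar>)"
  show "n = ?n"
  proof (rule ccontr)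
    assume "n \<noteq> ?n"
    with * n show False by (smt (verit))
  qed
qed

lemma L_continuation_unique:
  assumes "is_L_continuation \<tau> f" "is_L_continuation \<tau> g"
  shows "f = g"
proof
  fix z
  have f: "f nicely_meromorphic_on UNIV" and g: "g nicely_meromorphic_on UNIV"
    using assms by (auto simp: is_L_continuation_def)
  have fm: "f meromorphic_on UNIV" and gm: "g meromorphic_on UNIV"
    using f g by (auto simp: nicely_meromorphic_on_def)
  have hm: "(\<lambda>w. f w - g w) meromorphic_on UNIV"
    using fm gm by (intro meromorphic_intros)
  have "eventually (\<lambda>w. w \<in> {w. Re w > 1}) (at (2::complex))"
    by (rule eventually_at_in_open') (auto intro: open_halfspace_Re_gt)
  then have "eventually (\<lambda>w. f w - g w = 0) (at (2::complex))"
    by eventually_elim (use assms in \<open>auto simp: is_L_continuation_def\<close>)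
  then have freq: "frequently (\<lambda>w. f w - g w = 0) (at (2::complex))"
    by (rule eventually_frequently[rotated]) simp
  have "\<not> eventually (\<lambda>w. f w - g w \<noteq> 0) (cosparse UNIV)"
    using freq by (auto simp: eventually_cosparse_open_eq frequently_def)
  then have "eventually (\<lambda>w. f w - g w = 0) (cosparse UNIV)"
    using meromorphic_imp_constant_or_avoid[OF hm, of 0] by auto
  then have "eventually (\<lambda>w. f w = g w) (at z)"
    by (auto simp: eventually_cosparse_open_eq)
  then have "remove_sings f z = remove_sings g z"
    by (rule remove_sings_cong) simp
  moreover have "remove_sings h z = h z" if "h nicely_meromorphic_on UNIV" for h
    using that unfolding nicely_meromorphic_on_def
    by (metis UNIV_I remove_sings_at_pole remove_sings_eqI)
  ultimately show "f z = g z"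
    using f g by simp
qed

end

theory Submission
  imports Defs "HOL-Number_Theory.Number_Theory"
begin

text \<open>
  Fourier inversion writes \<open>L(s, \<tau>)\<close> as \<open>1/q\<close> times the combination, with Gauss sums as
  coefficients, of the periodic zeta functions \<open>F(a, s)\<close>, the continuation of
  \<open>\<Sum>n. e(n a) n\<^sup>-\<^sup>s\<close>, at \<open>a = r/q\<close>. The integral
  \<open>\<Gamma>(s + 1) F(a, s) = \<integral> t\<^sup>s E(t) dt\<close> over \<open>t > 0\<close>, with \<open>E(t) = \<Sum>n. n e(n a) e\<^sup>-\<^sup>n\<^sup>t\<close>,
  continues \<open>F(a, \<cdot>)\<close> to \<open>Re s > -1\<close>. The partial fraction expansion of \<open>E\<close> has
  the double poles \<open>2 \<pi> \<i> (k + a)\<close>; integrating it term by term for \<open>-1 < s < 0\<close> gives a formula in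
  Hurwitz series that makes sense for all \<open>Re s < 0\<close>. Both representations glue to an entire
  function, so continuation and functional equation come out together. For primitive \<open>\<tau>\<close>
  all Gauss sums have norm at most \<open>\<surd>q\<close>, whence the factor \<open>\<zeta>(1 - \<sigma>)\<close>.

  It remains to bound \<open>\<surd>(2/\<pi>) \<Gamma>(1 - s) sin (\<pi> s/2)\<close> and the analogous function with the cosine.
  A shift \<open>s \<mapsto> s + 1\<close> swaps them at the cost of a factor \<open>|s|\<close>, which produces the product and reduces
  the bound to \<open>-1/2 \<le> \<sigma> \<le> 1/2\<close>. There both functions have norm \<open>1\<close> and \<open>|1 + s|\<close> on the two boundary
  lines, and a Phragmen-Lindeloef argument interpolates.
\<close>

section \<open>The gamma factor\<close>

text \<open>
  The exponent \<open>1/2 - Re s\<close> varies with \<open>s\<close>, and the majorant \<open>|1 + s|\<^bsup>1/2 - Re s\<^esup>\<close> is not the norm of a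
  holomorphic function. For the given \<open>s\<close> it is replaced by \<open>e\<^sup>K\<close>, where, in the variable \<open>z = 1/2 - r\<close>,
  \<open>K\<close> is the cubic whose real part vanishes for \<open>Re z = 0\<close> and, for \<open>Re z = 1\<close>, is the tangent to the concave
  function \<open>ln (1/4 + y) / 2\<close> of \<open>y = (Im r)\<^sup>2\<close> at \<open>1/4 + y = R\<^sup>2 = |1 + s|\<^sup>2\<close>.
\<close>
lemma strip_convexity_bound:
  fixes f :: "complex \<Rightarrow> complex" and C c :: real
  assumes holo: "f holomorphic_on {s. Re s < 1}"
    and right: "\<And>s. Re s = 1/2 \<Longrightarrow> norm (f s) \<le> 1"
    and left: "\<And>s. Re s = -1/2 \<Longrightarrow> norm (f s) \<le> norm s"
    and growth: "\<And>s. -1/2 \<le> Re s \<Longrightarrow> Re s \<le> 1/2 \<Longrightarrow> norm (f s) \<le> C * exp (c * \<bar>Im s\<bar>)"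
    and s: "-1/2 \<le> Re s" "Re s \<le> 1/2"
  shows "norm (f s) \<le> norm (1 + s) powr (1/2 - Re s)"
proof -
  define x where "x = 1/2 - Re s"
  have x: "0 \<le> x" "x \<le> 1" using s by (auto simp: x_def)
  define R where "R = norm (1 + s)"
  have "Re (1 + s) > 0" using s by simp
  then have "1 + s \<noteq> 0" by force
  then have R: "R > 0" by (simp add: R_def)
  have R2: "R\<^sup>2 = (3/2 - x)\<^sup>2 + (Im s)\<^sup>2"
    by (simp add: R_def x_def cmod_power2 algebra_simps)
  define b where "b = 1 / (2 * R\<^sup>2)"
  have b: "b > 0" using R by (simp add: b_def)
  \<comment> \<open>\<open>A\<close> and \<open>b\<close> give
    \<open>Re (K r) = ln R + b * (u - R\<^sup>2)\<close> with
    \<open>u = 1/4 + (Im r)\<^sup>2\<close> when \<open>Re r = -1/2\<close>; the summand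
    \<open>b/3\<close> cancels the cubic term there.\<close>
  define A where "A = ln R - b * (R\<^sup>2 - 1/4) + b/3"
  define K where "K = (\<lambda>r. of_real A * (1/2 - r) - of_real (b/3) * (1/2 - r)^3 :: complex)"
  have ReK: "Re (K r) = A * (1/2 - Re r) + b * ((1/2 - Re r) * (Im r)\<^sup>2 - (1/2 - Re r)^3 / 3)" for r
    by (simp add: K_def power3_eq_cube power2_eq_square field_simps)
  have Re2: "Re ((1/2 - r)\<^sup>2) = (1/2 - Re r)\<^sup>2 - (Im r)\<^sup>2" for r :: complex
    by (simp add: power2_eq_square)
  \<comment> \<open>The factor \<open>exp (e * (1/2 - r)\<^sup>2)\<close> beats the growth bound on
    far horizontal edges, so the maximum principle applies to a rectangle. On the vertical edges it
    costs at most \<open>exp e\<close>, and letting \<open>e\<close> tend to 0 removes it.\<close>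
  have damped: "norm (f s * exp (- K s + of_real e * (1/2 - s)\<^sup>2)) \<le> exp e" if e: "e > 0" for e
  proof -
    let ?g = "\<lambda>r. f r * exp (- K r + of_real e * (1/2 - r)\<^sup>2)"
    have norm_g: "norm (?g r) = norm (f r) * exp (- Re (K r) + e * ((1/2 - Re r)\<^sup>2 - (Im r)\<^sup>2))" for r
    proof -
      have "Re (- K r + of_real e * (1/2 - r)\<^sup>2) = - Re (K r) + e * Re ((1/2 - r)\<^sup>2)" by simp
      then show ?thesis by (simp only: norm_mult norm_exp_eq_Re Re2)
    qed
    obtain T where T: "T > \<bar>Im s\<bar>" "ln (\<bar>C\<bar> + 1) + \<bar>c\<bar> * T + \<bar>A\<bar> + b/3 \<le> e * T\<^sup>2"
    proof -
      define D where "D = ln (\<bar>C\<bar> + 1) + \<bar>A\<bar> + b/3"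
      \<comment> \<open>Ensures \<open>T \<ge> 1\<close> and \<open>e * T \<ge> |c| + |D|\<close>,
        so that the quadratic \<open>e * T\<^sup>2\<close> dominates the linear
        \<open>|c| * T + D\<close>.\<close>
      define T where "T = \<bar>Im s\<bar> + 1 + (\<bar>c\<bar> + \<bar>D\<bar>) / e"
      have "T \<ge> 1" using e by (simp add: T_def)
      moreover have "\<bar>c\<bar> + \<bar>D\<bar> \<le> e * T" using e by (simp add: T_def field_simps)
      ultimately have "(\<bar>c\<bar> + \<bar>D\<bar>) * T \<le> e * T * T" by (intro mult_right_mono) auto
      moreover have "\<bar>D\<bar> * 1 \<le> \<bar>D\<bar> * T" using \<open>T \<ge> 1\<close> by (intro mult_left_mono) auto
      ultimately have "\<bar>c\<bar> * T + D \<le> e * T\<^sup>2" by (simp add: power2_eq_square algebra_simps)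
      moreover have "T > \<bar>Im s\<bar>" using e by (simp add: T_def add_pos_nonneg)
      ultimately show ?thesis by (intro that[of T]) (auto simp: D_def)
    qed
    let ?S = "cbox (Complex (-1/2) (-T)) (Complex (1/2) T)"
    show ?thesis
    proof (rule maximum_modulus_frontier[of ?g ?S])
      have sub: "?S \<subseteq> {s. Re s < 1}" by (auto simp: in_cbox_complex_iff)
      have "?g holomorphic_on {s. Re s < 1}"
        unfolding K_def by (intro holomorphic_intros holo)
      then have hol: "?g holomorphic_on ?S" using sub by (rule holomorphic_on_subset)
      then show "?g holomorphic_on interior ?S" by (rule holomorphic_on_subset[OF _ interior_subset])
      have "closure ?S = ?S" by (simp only: closure_cbox)
      with hol show "continuous_on (closure ?S) ?g"
        by (simp only: holomorphic_on_imp_continuous_on)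
    next
      fix r assume "r \<in> frontier ?S"
      then have r: "r \<in> ?S" "r \<notin> box (Complex (-1/2) (-T)) (Complex (1/2) T)"
        by (auto simp: frontier_def)
      define y where "y = 1/2 - Re r"
      have y: "0 \<le> y" "y \<le> 1" using r by (auto simp: in_cbox_complex_iff y_def)
      have "Re r = 1/2 \<or> Re r = -1/2 \<or> (- 1/2 \<le> Re r \<and> Re r \<le> 1/2 \<and> \<bar>Im r\<bar> = T)"
        using r by (auto simp: in_cbox_complex_iff in_box_complex_iff)
      then consider "Re r = 1/2" | "Re r = -1/2" | "- 1/2 \<le> Re r" "Re r \<le> 1/2" "\<bar>Im r\<bar> = T"
        by blast
      then show "norm (?g r) \<le> exp e"
      proof cases
        case 1
        have 0: "1/2 - Re r = 0" using 1 by simp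
        have "- (e * (Im r)\<^sup>2) \<le> e"
          using e by (smt (verit) mult_nonneg_nonneg zero_le_power2)
        then have "norm (?g r) \<le> 1 * exp e"
          unfolding norm_g ReK 0 using right[OF 1] e by (intro mult_mono) auto
        then show ?thesis by simp
      next
        case 2
        define u where "u = 1/4 + (Im r)\<^sup>2"
        have u: "u > 0" by (simp add: u_def add_pos_nonneg)
        have "norm r = sqrt u"
          unfolding u_def cmod_def using 2 by (simp add: power2_eq_square)
        then have nr: "norm r = exp (ln u / 2)" using u by (simp add: ln_sqrt[symmetric])
        \<comment> \<open>Concavity: the logarithm lies below its tangent, and half of that tangent
          is \<open>Re (K r)\<close> on this edge.\<close>
        have "ln (u / R\<^sup>2) \<le> u / R\<^sup>2 - 1" using u R by (intro ln_le_minus_one) auto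
        then have "ln u \<le> 2 * ln R + u / R\<^sup>2 - 1" using u R by (simp add: ln_div ln_realpow)
        moreover have "u / R\<^sup>2 - 1 = 2 * b * (u - R\<^sup>2)" using R by (simp add: b_def field_simps)
        ultimately have lu: "ln u / 2 \<le> Re (K r)"
          unfolding ReK A_def u_def using 2 by (simp add: algebra_simps)
        have "norm (?g r) \<le> exp (ln u / 2) * exp (- Re (K r) + e)"
          unfolding norm_g using left[OF 2] nr 2 e
          by (intro mult_mono) (auto simp: power2_eq_square algebra_simps)
        also have "\<dots> = exp (ln u / 2 - Re (K r) + e)" by (simp flip: exp_add)
        also have "\<dots> \<le> exp e" using lu by simp
        finally show ?thesis .
      next
        case 3
        have "norm (f r) \<le> C * exp (c * T)" using growth[OF 3(1,2)] 3(3) by simp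
        also have "\<dots> \<le> (\<bar>C\<bar> + 1) * exp (\<bar>c\<bar> * T)"
          using T(1) by (intro mult_mono) (auto intro: mult_right_mono)
        also have "\<dots> = exp (ln (\<bar>C\<bar> + 1) + \<bar>c\<bar> * T)" by (simp add: exp_add)
        finally have fr: "norm (f r) \<le> exp (ln (\<bar>C\<bar> + 1) + \<bar>c\<bar> * T)" .
        have "\<bar>A * y\<bar> \<le> \<bar>A\<bar>" using y by (simp add: abs_mult mult_left_le)
        then have "A * y \<ge> - \<bar>A\<bar>" by linarith
        moreover have "b * y ^ 3 / 3 \<le> b / 3" using b y power_le_one[of y 3] by simp
        moreover have "b * (y * (Im r)\<^sup>2) \<ge> 0" using b y by simp
        ultimately have K: "Re (K r) \<ge> - \<bar>A\<bar> - b/3"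
          unfolding ReK y_def[symmetric] by (simp add: algebra_simps)
        have "y\<^sup>2 \<le> 1" using y by (simp add: power_le_one)
        then have "e * (y\<^sup>2 - (Im r)\<^sup>2) \<le> e * (1 - T\<^sup>2)" using e 3(3) by auto
        then have "norm (?g r) \<le> exp (ln (\<bar>C\<bar> + 1) + \<bar>c\<bar> * T) * exp (\<bar>A\<bar> + b/3 + e * (1 - T\<^sup>2))"
          unfolding norm_g using K fr by (intro mult_mono) (auto simp: y_def)
        also have "\<dots> = exp (ln (\<bar>C\<bar> + 1) + \<bar>c\<bar> * T + \<bar>A\<bar> + b/3 - e * T\<^sup>2 + e)"
          by (simp add: algebra_simps flip: exp_add)
        also have "\<dots> \<le> exp e" using T(2) by simp
        finally show ?thesis .
      qed
    next
      show "s \<in> ?S" using s T(1) by (auto simp: in_cbox_complex_iff)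
    qed auto
  qed
  have "((\<lambda>e. norm (f s * exp (- K s + of_real e * (1/2 - s)\<^sup>2))) \<longlongrightarrow>
          norm (f s * exp (- K s + of_real 0 * (1/2 - s)\<^sup>2))) (at_right 0)"
    by (intro tendsto_intros)
  moreover have "((\<lambda>e::real. exp e) \<longlongrightarrow> exp 0) (at_right 0)" by (intro tendsto_intros)
  moreover have "\<forall>\<^sub>F e in at_right 0. norm (f s * exp (- K s + of_real e * (1/2 - s)\<^sup>2)) \<le> exp e"
    unfolding eventually_at_right_field by (intro exI[of _ 1]) (use damped in auto)
  ultimately have "norm (f s * exp (- K s + of_real 0 * (1/2 - s)\<^sup>2)) \<le> exp 0"
    by (intro tendsto_le[of "at_right (0::real)"]) auto
  then have "norm (f s) \<le> exp (Re (K s))"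
    by (simp add: norm_mult norm_divide exp_minus field_simps)
  also have "Re (K s) = x * ln R + x * b * (-(R\<^sup>2 - 1/4) + 1/3 + (Im s)\<^sup>2 - x\<^sup>2/3)"
    unfolding ReK x_def[symmetric] A_def by (simp add: algebra_simps power2_eq_square power3_eq_cube)
  \<comment> \<open>At \<open>s\<close> itself the cubic differs from \<open>x * ln R\<close> by
    \<open>- x * b * (1 - x) * (5 - 4 * x) / 3\<close>, which is at most 0 for
    \<open>0 \<le> x \<le> 1\<close>; hence no constant is lost.\<close>
  also have "- (R\<^sup>2 - 1/4) + 1/3 + (Im s)\<^sup>2 - x\<^sup>2/3 = - ((1 - x) * (5 - 4 * x) / 3)"
    unfolding R2 by (simp add: field_simps power2_eq_square)
  also have "x * ln R + x * b * (- ((1 - x) * (5 - 4 * x) / 3)) \<le> x * ln R"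
    using x b by simp
  finally show ?thesis using R by (simp add: powr_def R_def[symmetric] x_def)
qed

text \<open>The functional equation leads to \<open>g = sin\<close> for even characters and to
  \<open>g = cos\<close> for odd ones. The constant normalises the norm to 1 on the line
  \<open>Re s = 1/2\<close>.\<close>

definition gamma_factor :: "(complex \<Rightarrow> complex) \<Rightarrow> complex \<Rightarrow> complex" where
  "gamma_factor g s = of_real (sqrt (2 / pi)) * Gamma (1 - s) * g (of_real pi * s / 2)"

section \<open>Shifts and bounds of the gamma factor\<close>

lemma norm_sin_complex_le: "norm (sin z) \<le> exp \<bar>Im z\<bar>"
  and norm_cos_complex_le: "norm (cos z) \<le> exp \<bar>Im z\<bar>" for z :: complex
proof -
  have "norm (exp (\<i> * z)) \<le> exp \<bar>Im z\<bar>" "norm (exp (-(\<i> * z))) \<le> exp \<bar>Im z\<bar>"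
    by auto
  then have "norm (exp (\<i> * z) - exp (-(\<i> * z))) \<le> 2 * exp \<bar>Im z\<bar>"
            "norm (exp (\<i> * z) + exp (-(\<i> * z))) \<le> 2 * exp \<bar>Im z\<bar>"
    using norm_triangle_ineq4[of "exp (\<i> * z)" "exp (-(\<i> * z))"]
          norm_triangle_ineq[of "exp (\<i> * z)" "exp (-(\<i> * z))"] by linarith+
  then show "norm (sin z) \<le> exp \<bar>Im z\<bar>" "norm (cos z) \<le> exp \<bar>Im z\<bar>"
    unfolding sin_exp_eq cos_exp_eq by (simp_all add: norm_divide norm_mult)
qed

text \<open>The norm of the integrand in Euler's integral depends on \<open>Re z\<close>
  only.\<close>

lemma norm_Gamma_le_Gamma_Re:
  assumes "Re z > 0"
  shows "norm (Gamma z) \<le> Gamma (Re z)"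
proof -
  have 1: "((\<lambda>t. of_real t powr (z - 1) / of_real (exp t)) has_integral Gamma z) {0..}"
    by (rule Gamma_integral_complex) fact
  have 2: "((\<lambda>t. t powr (Re z - 1) / exp t) has_integral Gamma (Re z)) {0..}"
    by (rule Gamma_integral_real) fact
  have "norm (integral {0..} (\<lambda>t. of_real t powr (z - 1) / of_real (exp t))) \<le>
        integral {0..} (\<lambda>t. t powr (Re z - 1) / exp t)"
    by (intro integral_norm_bound_integral has_integral_integrable[OF 1] has_integral_integrable[OF 2])
       (auto simp: norm_divide norm_powr_real_powr)
  with 1 2 show ?thesis by (simp add: has_integral_iff)
qed

lemma Re_pos_notin_nonpos_Ints: "Re z > 0 \<Longrightarrow> z \<notin> \<int>\<^sub>\<le>\<^sub>0"
  by (auto elim!: nonpos_Ints_cases)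

text \<open>\<open>Gamma (1 - s) = - s * Gamma (- s)\<close> yields the factor \<open>s\<close>, and
  moving \<open>s\<close> by 1 moves the trigonometric argument by a quarter period.\<close>

lemma gamma_factor_shift_sin:
  "Re s < 0 \<Longrightarrow> norm (gamma_factor sin s) = norm s * norm (gamma_factor cos (s + 1))"
  and gamma_factor_shift_cos:
  "Re s < 0 \<Longrightarrow> norm (gamma_factor cos s) = norm s * norm (gamma_factor sin (s + 1))"
proof -
  assume "Re s < 0"
  then have "-s \<notin> \<int>\<^sub>\<le>\<^sub>0"
    by (intro Re_pos_notin_nonpos_Ints) simp
  then have G: "Gamma (1 - s) = -s * Gamma (1 - (s + 1))"
    using Gamma_plus1[of "-s"] by simp
  have "of_real pi * (s + 1) / 2 = of_real pi * s / 2 + of_real (pi / 2)" by (simp add: field_simps)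
  then have "sin (of_real pi * (s + 1) / 2) = cos (of_real pi * s / 2)"
            "cos (of_real pi * (s + 1) / 2) = - sin (of_real pi * s / 2)"
    by (simp_all only: sin_add cos_add sin_of_real cos_of_real) simp_all
  then show "norm (gamma_factor sin s) = norm s * norm (gamma_factor cos (s + 1))"
       "norm (gamma_factor cos s) = norm s * norm (gamma_factor sin (s + 1))"
    unfolding gamma_factor_def G by (simp_all add: norm_mult)
qed

text \<open>Here \<open>1 - s = cnj s\<close>, so the reflection formula gives
  \<open>pi / cosh y\<close> for the squared norm of \<open>Gamma (1 - s)\<close>, with
  \<open>y = pi * Im s\<close>. At real part \<open>pi/4\<close> sine and cosine both have squared
  norm \<open>cosh y / 2\<close>, and the factor \<open>2 / pi\<close> cancels the rest.\<close>

lemma gamma_factor_critical_line: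
  assumes "Re s = 1/2"
  shows "norm (gamma_factor sin s) = 1" "norm (gamma_factor cos s) = 1"
proof -
  define y where "y = pi * Im s"
  have cn: "1 - s = cnj s" using assms by (simp add: complex_eq_iff)
  have "norm (Gamma s) = norm (Gamma (1 - s))" unfolding cn by (metis cnj_Gamma complex_mod_cnj)
  then have "(norm (Gamma (1 - s)))\<^sup>2 = norm (Gamma s * Gamma (1 - s))"
    by (simp add: norm_mult power2_eq_square)
  also have "\<dots> = pi / norm (sin (of_real pi * s))"
    by (simp add: Gamma_reflection_complex norm_divide)
  also have "of_real pi * s = Complex (pi/2) y"
    using assms by (simp add: complex_eq_iff y_def)
  also have "norm (sin (Complex (pi/2) y)) = cosh y"
  proof -
    have "sin (Complex (pi/2) y) = of_real (cosh y)"
      by (rule complex_eqI) (simp_all add: Re_sin Im_sin cosh_def)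
    then show ?thesis by simp
  qed
  finally have G: "(norm (Gamma (1 - s)))\<^sup>2 = pi / cosh y" .
  have arg: "of_real pi * s / 2 = Complex (pi/4) (y/2)"
    using assms by (simp add: complex_eq_iff y_def)
  define a b where "a = exp (y/2)" and "b = exp (-(y/2))"
  have "exp y = a\<^sup>2" "exp (-y) = b\<^sup>2"
    by (simp_all add: a_def b_def power2_eq_square flip: exp_add)
  then have ch: "cosh y = (a\<^sup>2 + b\<^sup>2) / 2" by (simp add: cosh_def)
  have *: "(u * ((a + b) / 2))\<^sup>2 + (u * ((a - b) / 2))\<^sup>2 = u\<^sup>2 * (a\<^sup>2 + b\<^sup>2) / 2" for u
    by (simp add: power2_eq_square field_simps)
  have u2: "(sqrt 2 / 2)\<^sup>2 = (1/2 :: real)" by (simp add: power_divide)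
  have S: "(norm (sin (of_real pi * s / 2)))\<^sup>2 = cosh y / 2"
    unfolding arg cmod_power2 Re_sin Im_sin ch
    using *[of "sqrt 2 / 2"] unfolding u2
    by (simp only: complex.sel sin_45 cos_45 a_def[symmetric] b_def[symmetric] times_divide_eq_right)
  have C: "(norm (cos (of_real pi * s / 2)))\<^sup>2 = cosh y / 2"
    unfolding arg cmod_power2 Re_cos Im_cos ch
    using *[of "sqrt 2 / 2"] unfolding u2
    by (simp only: complex.sel sin_45 cos_45 a_def[symmetric] b_def[symmetric] times_divide_eq_right
          power2_commute[of b a] power_mult_distrib power_divide)
  have "cosh y > 0" by simp
  then have "(norm (gamma_factor sin s))\<^sup>2 = 1\<^sup>2" "(norm (gamma_factor cos s))\<^sup>2 = 1\<^sup>2"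
    unfolding gamma_factor_def norm_mult power_mult_distrib G S C by simp_all
  then show "norm (gamma_factor sin s) = 1" "norm (gamma_factor cos s) = 1"
    by (metis norm_ge_zero power2_eq_imp_eq zero_le_one)+
qed

text \<open>A crude estimate that makes the convexity argument applicable:
  \<open>Gamma (1 - s)\<close> is controlled by real values on the compact interval from 1/2 to 3/2,
  and sine and cosine grow at most exponentially.\<close>

lemma gamma_factor_growth:
  assumes g: "g = sin \<or> g = cos"
  obtains C where "\<And>s. -1/2 \<le> Re s \<Longrightarrow> Re s \<le> 1/2 \<Longrightarrow>
    norm (gamma_factor g s) \<le> C * exp (pi / 2 * \<bar>Im s\<bar>)"
proof -
  have "continuous_on {1/2..3/2} (Gamma :: real \<Rightarrow> real)"
    by (intro continuous_intros) (auto elim!: nonpos_Ints_cases)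
  then have "bounded ((Gamma :: real \<Rightarrow> real) ` {1/2..3/2})"
    by (intro compact_imp_bounded compact_continuous_image) auto
  then obtain B where B: "norm (Gamma x) \<le> B" if "x \<in> {1/2..3/2}" for x :: real
    unfolding bounded_iff by blast
  show ?thesis
  proof (rule that)
    fix s :: complex assume s: "-1/2 \<le> Re s" "Re s \<le> 1/2"
    have "norm (Gamma (1 - s)) \<le> Gamma (1 - Re s)"
      using norm_Gamma_le_Gamma_Re[of "1 - s"] s by simp
    also have "\<dots> \<le> B" using B[of "1 - Re s"] s by simp
    finally have G: "norm (Gamma (1 - s)) \<le> B" .
    have "norm (g (of_real pi * s / 2)) \<le> exp \<bar>Im (of_real pi * s / 2)\<bar>"
      using g norm_sin_complex_le[of "of_real pi * s / 2"] norm_cos_complex_le[of "of_real pi * s / 2"]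
      by (elim disjE) (simp_all only:)
    then have "norm (g (of_real pi * s / 2)) \<le> exp (pi / 2 * \<bar>Im s\<bar>)"
      by (simp add: abs_mult)
    with G have "norm (Gamma (1 - s)) * norm (g (of_real pi * s / 2)) \<le> B * exp (pi / 2 * \<bar>Im s\<bar>)"
      by (intro mult_mono) (auto intro: order_trans[OF norm_ge_zero])
    then have "sqrt (2/pi) * (norm (Gamma (1 - s)) * norm (g (of_real pi * s / 2)))
        \<le> sqrt (2/pi) * (B * exp (pi / 2 * \<bar>Im s\<bar>))"
      by (rule mult_left_mono) simp
    then show "norm (gamma_factor g s) \<le> (sqrt (2/pi) * B) * exp (pi / 2 * \<bar>Im s\<bar>)"
      by (simp add: gamma_factor_def norm_mult mult.assoc)
  qed
qed

text \<open>Both edges come from the critical line: the left one is its translate by -1, where the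
  shift rule supplies the factor \<open>norm r\<close>.\<close>

lemma gamma_factor_strip_bound:
  assumes g: "g = sin \<or> g = cos" and s: "-1/2 \<le> Re s" "Re s \<le> 1/2"
  shows "norm (gamma_factor g s) \<le> norm (1 + s) powr (1/2 - Re s)"
proof -
  obtain C where C: "\<And>s. -1/2 \<le> Re s \<Longrightarrow> Re s \<le> 1/2 \<Longrightarrow>
    norm (gamma_factor g s) \<le> C * exp (pi / 2 * \<bar>Im s\<bar>)"
    using gamma_factor_growth[OF g] by blast
  show ?thesis
  proof (rule strip_convexity_bound[OF _ _ _ C s])
    have "(\<lambda>s. g (of_real pi * s / 2)) holomorphic_on {s. Re s < 1}"
      using g by (elim disjE; simp only:) (intro holomorphic_intros; simp)+
    then show "gamma_factor g holomorphic_on {s. Re s < 1}"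
      unfolding gamma_factor_def
      by (intro holomorphic_intros) (auto intro!: Re_pos_notin_nonpos_Ints)
  next
    fix r :: complex assume "Re r = 1/2"
    then show "norm (gamma_factor g r) \<le> 1" using gamma_factor_critical_line g by auto
  next
    fix r :: complex assume r: "Re r = -1/2"
    then have "norm (gamma_factor sin (r+1)) = 1" "norm (gamma_factor cos (r+1)) = 1"
      by (simp_all add: gamma_factor_critical_line)
    with r show "norm (gamma_factor g r) \<le> norm r"
      using gamma_factor_shift_sin[of r] gamma_factor_shift_cos[of r] g by auto
  qed
qed

text \<open>Each unit shift to the right peels off one factor of the product and swaps sine and
  cosine, which is why \<open>g\<close> is generalised in the induction.\<close>

lemma gamma_factor_bound:
  assumes g: "g = sin \<or> g = cos" and s: "-1/2 - real n \<le> Re s" "Re s \<le> 1/2 - real n"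
  shows "norm (gamma_factor g s) \<le>
    norm (s + of_nat n + 1) powr (1/2 - Re s - real n) * (\<Prod>j<n. norm (s + of_nat j))"
  using assms
proof (induction n arbitrary: g s)
  case 0
  then show ?case using gamma_factor_strip_bound[of g s] by (simp add: add_ac)
next
  case (Suc n)
  define h :: "complex \<Rightarrow> complex" where "h = (if g = sin then cos else sin)"
  have "Re s < 0" using Suc.prems by simp
  then have "norm (gamma_factor g s) = norm s * norm (gamma_factor h (s + 1))"
    using gamma_factor_shift_sin gamma_factor_shift_cos Suc.prems(1) by (auto simp: h_def)
  also have "norm (gamma_factor h (s + 1)) \<le>
      norm (s + 1 + of_nat n + 1) powr (1/2 - Re (s + 1) - real n) * (\<Prod>j<n. norm (s + 1 + of_nat j))"
    by (rule Suc.IH) (use Suc.prems in \<open>auto simp: h_def\<close>)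
  also have "norm s * (norm (s + 1 + of_nat n + 1) powr (1/2 - Re (s + 1) - real n) * (\<Prod>j<n. norm (s + 1 + of_nat j)))
     = norm (s + of_nat (Suc n) + 1) powr (1/2 - Re s - real (Suc n)) * (\<Prod>j<Suc n. norm (s + of_nat j))"
    by (subst prod.lessThan_Suc_shift) (simp add: algebra_simps)
  finally show ?case by (simp add: mult_left_mono)
qed

section \<open>Mellin transforms\<close>

text \<open>Dominated convergence for difference quotients. A local majorant of the function itself
  suffices, because Cauchy's inequality converts it into one for the derivative and hence for the
  quotients.\<close>

lemma holomorphic_on_parametric_integral:
  fixes f :: "complex \<Rightarrow> 'a \<Rightarrow> complex"
  assumes S: "open S"
    and meas: "\<And>z. z \<in> S \<Longrightarrow> f z \<in> borel_measurable M"
    and holo: "\<And>x. x \<in> space M \<Longrightarrow> (\<lambda>z. f z x) holomorphic_on S"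
    and dom: "\<And>z. z \<in> S \<Longrightarrow> \<exists>r g. r > 0 \<and> integrable M g \<and>
                 (\<forall>w \<in> ball z r \<inter> S. \<forall>x \<in> space M. norm (f w x) \<le> g x)"
  shows "(\<lambda>z. integral\<^sup>L M (f z)) holomorphic_on S"
  unfolding holomorphic_on_def
proof (rule ballI)
  fix z assume z: "z \<in> S"
  obtain r0 g where r0: "r0 > 0" and g: "integrable M g"
    and gb: "\<And>w x. w \<in> ball z r0 \<Longrightarrow> w \<in> S \<Longrightarrow> x \<in> space M \<Longrightarrow> norm (f w x) \<le> g x"
    using dom[OF z] by blast
  obtain r1 where r1: "r1 > 0" "ball z r1 \<subseteq> S" using S z open_contains_ball by blast
  \<comment> \<open>Closed balls of radius \<open>r\<close> around points of \<open>ball z r\<close>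
    stay within distance \<open>2 * r\<close> of \<open>z\<close>, hence inside \<open>S\<close> and
    where the majorant is valid.\<close>
  define r where "r = min r0 r1 / 4"
  have r: "r > 0" using r0 r1 by (simp add: r_def)
  have ball: "w \<in> S" "w \<in> ball z r0" if "dist z w \<le> 2 * r" for w
    using that r0 r1 by (auto simp: r_def min_def split: if_splits)
  have int: "integrable M (f w)" if "dist z w \<le> 2 * r" for w
    by (rule Bochner_Integration.integrable_bound[OF g meas])
       (use ball[OF that] gb in \<open>auto intro!: AE_I2 order_trans[OF _ abs_ge_self]\<close>)
  let ?f' = "\<lambda>x. deriv (\<lambda>z. f z x) z"
  have lip: "norm (f w x - f z x) \<le> (g x / r) * norm (w - z)"
    if w: "w \<in> ball z r" and x: "x \<in> space M" for w x
  proof (rule field_differentiable_bound[where S = "ball z r" and f' = "deriv (\<lambda>z. f z x)"])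
    fix v assume v: "v \<in> ball z r"
    have "dist z v \<le> 2 * r" using v r by simp
    then have vS: "v \<in> S" by (rule ball)
    show "((\<lambda>z. f z x) has_field_derivative deriv (\<lambda>z. f z x) v) (at v within ball z r)"
      by (rule has_field_derivative_at_within[OF holomorphic_derivI[OF holo[OF x] S vS]])
    have sub: "cball v r \<subseteq> S"
    proof
      fix u assume "u \<in> cball v r"
      then have "dist z u \<le> 2 * r" using v dist_triangle[of z u v] by auto
      then show "u \<in> S" using ball by blast
    qed
    have "norm ((deriv ^^ 1) (\<lambda>z. f z x) v) \<le> fact 1 * g x / r ^ 1"
    proof (rule Cauchy_inequality)
      show "(\<lambda>z. f z x) holomorphic_on ball v r"
        using holo[OF x] sub holomorphic_on_subset by (meson ball_subset_cball order_trans)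
      show "continuous_on (cball v r) (\<lambda>z. f z x)"
        using holo[OF x] sub holomorphic_on_imp_continuous_on holomorphic_on_subset by blast
      fix u assume "norm (v - u) = r"
      then have "dist z u \<le> 2 * r" using v dist_triangle[of z u v] by (auto simp: dist_norm)
      then show "norm (f u x) \<le> g x" using ball[of u] gb x by blast
    qed (use r in auto)
    then show "norm (deriv (\<lambda>z. f z x) v) \<le> g x / r" by simp
  qed (use w r in auto)
  have "((\<lambda>w. (integral\<^sup>L M (f w) - integral\<^sup>L M (f z)) / (w - z)) \<longlongrightarrow> integral\<^sup>L M ?f') (at z within ball z r)"
    unfolding tendsto_at_iff_sequentially o_def
  proof (intro allI impI)
    fix w assume w: "\<forall>i. w i \<in> ball z r - {z}" and wl: "w \<longlonglongrightarrow> z"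
    have wd: "dist z (w i) \<le> 2 * r" "w i \<noteq> z" "w i \<in> ball z r" for i
    proof -
      have "w i \<in> ball z r - {z}" using w by blast
      then show "dist z (w i) \<le> 2 * r" "w i \<noteq> z" "w i \<in> ball z r" using r by simp_all
    qed
    have lim: "(\<lambda>i. (f (w i) x - f z x) / (w i - z)) \<longlonglongrightarrow> ?f' x" if x: "x \<in> space M" for x
    proof -
      have "((\<lambda>z. f z x) has_field_derivative ?f' x) (at z)"
        using holo[OF x] S z by (rule holomorphic_derivI)
      then have "((\<lambda>w. (f w x - f z x) / (w - z)) \<longlongrightarrow> ?f' x) (at z)"
        by (simp add: has_field_derivative_iff)
      then show ?thesis
        by (rule filterlim_compose) (use wl wd in \<open>auto simp: filterlim_at\<close>)
    qed
    have m: "(\<lambda>x. (f (w i) x - f z x) / (w i - z)) \<in> borel_measurable M" for i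
      using meas[OF z] meas[OF ball(1)[OF wd(1)]] by (intro borel_measurable_divide borel_measurable_diff) auto
    have "(\<lambda>i. LINT x|M. (f (w i) x - f z x) / (w i - z)) \<longlonglongrightarrow> integral\<^sup>L M ?f'"
    proof (rule integral_dominated_convergence[where w = "\<lambda>x. g x / r"])
      show "?f' \<in> borel_measurable M"
        by (rule borel_measurable_LIMSEQ_metric[OF m lim])
      show "integrable M (\<lambda>x. g x / r)" using g by simp
      show "AE x in M. (\<lambda>i. (f (w i) x - f z x) / (w i - z)) \<longlonglongrightarrow> ?f' x" using lim by (intro AE_I2)
      show "AE x in M. norm ((f (w i) x - f z x) / (w i - z)) \<le> g x / r" for i
        using lip[OF wd(3)] wd(2) by (intro AE_I2) (auto simp: norm_divide field_simps)
    qed (rule m)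
    moreover have "(LINT x|M. (f (w i) x - f z x) / (w i - z)) = (integral\<^sup>L M (f (w i)) - integral\<^sup>L M (f z)) / (w i - z)" for i
      using int[of z] int[OF wd(1)] r by (simp only: integral_divide_zero Bochner_Integration.integral_diff dist_self mult_nonneg_nonneg less_imp_le zero_le_numeral)
    ultimately show "(\<lambda>i. (integral\<^sup>L M (f (w i)) - integral\<^sup>L M (f z)) / (w i - z)) \<longlonglongrightarrow> integral\<^sup>L M ?f'"
      by (simp only:)
  qed
  then have "((\<lambda>z. integral\<^sup>L M (f z)) has_field_derivative integral\<^sup>L M ?f') (at z)"
    using r by (simp add: has_field_derivative_iff at_within_open[of z "ball z r"])
  then show "(\<lambda>z. integral\<^sup>L M (f z)) field_differentiable at z within S"
    using field_differentiable_at_within field_differentiable_def by blast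
qed

section \<open>Integrals over the positive reals\<close>

abbreviation pos_reals :: "real measure" where
  "pos_reals \<equiv> restrict_space lborel {0<..}"

lemma space_pos_reals [simp]: "space pos_reals = {0<..}"
  by (simp add: space_restrict_space)

lemma integrable_pos_realsI:
  fixes f :: "real \<Rightarrow> real"
  assumes "f \<in> borel_measurable borel" "\<And>t. t > 0 \<Longrightarrow> f t \<ge> 0"
    and "(\<integral>\<^sup>+t. ennreal (f t) \<partial>pos_reals) = ennreal c" "c \<ge> 0"
  shows "integrable pos_reals f" "integral\<^sup>L pos_reals f = c"
proof -
  have m: "f \<in> borel_measurable pos_reals" using assms(1) by (intro measurable_restrict_space1) simp
  have "has_bochner_integral pos_reals f c"
    using assms by (intro has_bochner_integral_nn_integral m) (auto intro!: AE_I2)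
  then show "integrable pos_reals f" "integral\<^sup>L pos_reals f = c"
    by (auto simp: has_bochner_integral_iff)
qed

text \<open>The substitution \<open>c * t\<close> reduces this to Euler's integral. The power is an
  exponential of the logarithm to match the complex case, where this form is entire in the
  exponent.\<close>

lemma nn_integral_powr_exp:
  assumes "a > -1" "c > (0::real)"
  shows "(\<integral>\<^sup>+t. ennreal (exp (a * ln t) * exp (- (c * t))) \<partial>pos_reals) =
           ennreal (Gamma (a + 1) * c powr (-a-1))"
proof -
  have "(\<integral>\<^sup>+t. ennreal (exp (a * ln t) * exp (- (c * t))) \<partial>pos_reals) =
        (\<integral>\<^sup>+t. ennreal (exp (a * ln t) * exp (- (c * t))) * indicator {0<..} t \<partial>lborel)"
    by (subst nn_integral_restrict_space) auto
  also have "\<dots> = (\<integral>\<^sup>+t. ennreal (c powr (-a)) * ennreal (indicator {0..} (c * t) * (c * t) powr a / exp (c * t)) \<partial>lborel)"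
    by (intro nn_integral_cong_AE eventually_mono[OF AE_lborel_singleton[of 0]])
       (use assms in \<open>auto simp: indicator_def powr_def ln_mult exp_minus field_simps zero_le_mult_iff
          simp flip: ennreal_mult exp_add\<close>)
  also have "\<dots> = ennreal (c powr (-a)) * (\<integral>\<^sup>+t. ennreal (indicator {0..} (c * t) * (c * t) powr a / exp (c * t)) \<partial>lborel)"
    by (rule nn_integral_cmult) measurable
  also have "\<dots> = ennreal (c powr (-a)) * (ennreal (1/c) * Gamma (a + 1))"
  proof -
    have "ennreal (Gamma (a + 1)) = ennreal c * (\<integral>\<^sup>+t. ennreal (indicator {0..} (c * t) * (c * t) powr a / exp (c * t)) \<partial>lborel)"
      using nn_integral_real_affine[of "\<lambda>t. ennreal (indicator {0..} t * t powr a / exp t)" c 0] assms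
      by (simp add: Gamma_conv_nn_integral_real)
    then have "ennreal (1/c) * ennreal (Gamma (a + 1)) = ennreal (1/c) * ennreal c * (\<integral>\<^sup>+t. ennreal (indicator {0..} (c * t) * (c * t) powr a / exp (c * t)) \<partial>lborel)"
      by (simp add: mult.assoc)
    also have "ennreal (1/c) * ennreal c = 1" using assms by (simp flip: ennreal_mult)
    finally show ?thesis by simp
  qed
  also have "\<dots> = ennreal (Gamma (a + 1) * c powr (-a-1))"
    using assms by (simp add: powr_diff Gamma_real_nonneg mult_ac flip: ennreal_mult)
  finally show ?thesis .
qed

text \<open>The identity theorem in the form that carries formulas from real to complex parameters;
  the midpoint of the interval serves as the limit point.\<close>

lemma holomorphic_eq_if_eq_on_reals:
  assumes hol: "f holomorphic_on S" "g holomorphic_on S" and S: "open S" "connected S"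
    and ab: "a < b"
    and sub: "\<And>x. a < x \<Longrightarrow> x < b \<Longrightarrow> of_real x \<in> S"
    and eq: "\<And>x. a < x \<Longrightarrow> x < b \<Longrightarrow> f (of_real x) = g (of_real x)"
    and z: "z \<in> S"
  shows "f z = g z"
proof -
  define U where "U = complex_of_real ` {a<..<b}"
  define m where "m = (a + b) / 2"
  have "complex_of_real m islimpt U"
    unfolding islimpt_approachable
  proof (intro allI impI)
    fix e :: real assume e: "e > 0"
    define x where "x = m + min (e/2) ((b - a) / 4)"
    have "x > m" "x < b" "x > a" "x - m < e" using e ab
      by (auto simp: x_def m_def min_def field_simps)
    then show "\<exists>y\<in>U. y \<noteq> of_real m \<and> dist y (of_real m) < e"
      by (intro bexI[of _ "of_real x"]) (auto simp: U_def dist_of_real dist_real_def)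
  qed
  moreover have "U \<subseteq> S" using sub by (auto simp: U_def)
  moreover have "of_real m \<in> S" using ab by (intro sub) (auto simp: m_def)
  moreover have "(\<lambda>w. f w - g w) holomorphic_on S" using hol by (intro holomorphic_intros)
  ultimately have "f z - g z = 0"
    using S z eq by (intro analytic_continuation[of "\<lambda>w. f w - g w" S U "of_real m" z]) (auto simp: U_def)
  then show ?thesis by simp
qed

lemma borel_measurable_mellin:
  assumes "h \<in> borel_measurable borel"
  shows "(\<lambda>t. exp (s * complex_of_real (ln t)) * h t) \<in> borel_measurable pos_reals"
  by (intro measurable_restrict_space1) (use assms in measurable)

text \<open>The decay of \<open>h\<close> controls the integrand at infinity, and
  \<open>Re s > -1\<close> controls it at 0, where \<open>h\<close> is bounded.\<close>

lemma mellin_exponential_decay: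
  fixes h :: "real \<Rightarrow> complex"
  assumes h [measurable]: "h \<in> borel_measurable borel" and c: "c > 0"
    and bound: "\<And>t. t > 0 \<Longrightarrow> norm (h t) \<le> C * exp (- (c * t))"
  shows "(\<lambda>s. LINT t|pos_reals. exp (s * complex_of_real (ln t)) * h t) holomorphic_on {s. Re s > -1}"
    and "\<And>s. Re s > -1 \<Longrightarrow> integrable pos_reals (\<lambda>t. exp (s * complex_of_real (ln t)) * h t)"
proof -
  have int: "integrable pos_reals (\<lambda>t. C * (exp (a * ln t) * exp (- (c * t))))" if "a > -1" for a :: real
  proof -
    have "integrable pos_reals (\<lambda>t. exp (a * ln t) * exp (- (c * t)))"
      by (rule integrable_pos_realsI[OF _ _ nn_integral_powr_exp[OF that c]])
         (use that in \<open>auto intro: Gamma_real_nonneg\<close>)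
    then show ?thesis by simp
  qed
  have nrm: "norm (exp (s * complex_of_real (ln t)) * h t) \<le> C * (exp (Re s * ln t) * exp (- (c * t)))"
    if "t > 0" for s t
    using mult_left_mono[OF bound[OF that], of "exp (Re s * ln t)"] by (simp add: norm_mult mult_ac)
  show "integrable pos_reals (\<lambda>t. exp (s * complex_of_real (ln t)) * h t)" if "Re s > -1" for s
    by (rule Bochner_Integration.integrable_bound[OF int[OF that] borel_measurable_mellin[OF h]])
       (auto intro!: AE_I2 order_trans[OF nrm])
  have C: "C \<ge> 0" using bound[of 1] by (smt (verit) exp_gt_zero norm_ge_zero zero_le_mult_iff)
  show "(\<lambda>s. LINT t|pos_reals. exp (s * complex_of_real (ln t)) * h t) holomorphic_on {s. Re s > -1}"
  proof (rule holomorphic_on_parametric_integral)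
    show "open {s. Re s > -1}" by (rule open_halfspace_Re_gt)
    show "(\<lambda>t. exp (z * complex_of_real (ln t)) * h t) \<in> borel_measurable pos_reals" for z
      by (rule borel_measurable_mellin[OF h])
    show "(\<lambda>z. exp (z * complex_of_real (ln x)) * h x) holomorphic_on {s. - 1 < Re s}" for x
      by (intro holomorphic_intros)
    fix z assume z: "z \<in> {s. - 1 < Re s}"
    define r where "r = (Re z + 1) / 2"
    \<comment> \<open>For \<open>w\<close> in the ball, \<open>Re w\<close> lies between
      \<open>Re z - r\<close> and \<open>Re z + r\<close>. The first power dominates for
      \<open>t < 1\<close>, the second for \<open>t \<ge> 1\<close>, so their sum is a majorant
      uniform in \<open>w\<close>.\<close>
    let ?g = "\<lambda>t. C * (exp ((Re z - r) * ln t) * exp (- (c * t))) + C * (exp ((Re z + r) * ln t) * exp (- (c * t)))"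
    have r: "r > 0" "Re z - r > -1" "Re z + r > -1" using z by (auto simp: r_def field_simps)
    have "integrable pos_reals ?g" using r by (intro Bochner_Integration.integrable_add int)
    moreover have "norm (exp (w * complex_of_real (ln t)) * h t) \<le> ?g t" if w: "w \<in> ball z r" and t: "t > 0" for w t
    proof -
      have "\<bar>Re w - Re z\<bar> < r" using w abs_Re_le_cmod[of "w - z"] by (simp add: dist_norm norm_minus_commute)
      then have w': "Re z - r \<le> Re w" "Re w \<le> Re z + r" by auto
      have "exp (Re w * ln t) \<le> exp ((Re z - r) * ln t) + exp ((Re z + r) * ln t)"
      proof (cases "ln t \<ge> 0")
        case True
        then have "exp (Re w * ln t) \<le> exp ((Re z + r) * ln t)" using w' by (simp add: mult_right_mono)
        then show ?thesis by (simp add: add_increasing)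
      next
        case False
        then have "exp (Re w * ln t) \<le> exp ((Re z - r) * ln t)" using w' by (simp add: mult_right_mono_neg)
        then show ?thesis by (simp add: add_increasing2)
      qed
      then have "C * (exp (Re w * ln t) * exp (- (c * t))) \<le> C * ((exp ((Re z - r) * ln t) + exp ((Re z + r) * ln t)) * exp (- (c * t)))"
        using C by (intro mult_left_mono mult_right_mono) auto
      then show ?thesis using nrm[OF t, of w] by (simp add: algebra_simps)
    qed
    ultimately show "\<exists>r g. r > 0 \<and> integrable pos_reals g \<and> (\<forall>w\<in>ball z r \<inter> {s. - 1 < Re s}.
        \<forall>x\<in>space pos_reals. norm (exp (w * complex_of_real (ln x)) * h x) \<le> g x)"
      using r(1) by (intro exI[of _ r] exI[of _ ?g]) auto
  qed
qed

text \<open>On the real segment from 0 to 1 this is Euler's integral; both sides are holomorphic in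
  the half-plane, so the identity theorem extends it.\<close>

lemma mellin_exp:
  assumes c: "c > 0" and s: "Re s > -1"
  shows "(LINT t|pos_reals. exp (s * complex_of_real (ln t)) * of_real (exp (- (c * t)))) =
           Gamma (s + 1) * exp (- (s + 1) * of_real (ln c))" (is "?l s = ?r s")
proof (rule holomorphic_eq_if_eq_on_reals[where f = ?l and g = ?r and S = "{s. Re s > -1}" and a = 0 and b = 1])
  show "?l holomorphic_on {s. Re s > -1}"
    by (rule mellin_exponential_decay[where C = 1 and c = c]) (use c in auto)
  have "s + 1 \<notin> \<int>\<^sub>\<le>\<^sub>0" if "Re s > -1" for s
    using that by (auto elim!: nonpos_Ints_cases simp: complex_eq_iff)
  then show "?r holomorphic_on {s. Re s > -1}"
    by (intro holomorphic_intros) auto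
  show "open {s. Re s > -1}" by (rule open_halfspace_Re_gt)
  show "connected {s. Re s > -1}" by (intro convex_connected convex_halfspace_Re_gt)
  fix x :: real assume x: "0 < x" "x < 1"
  have "?l (of_real x) = (LINT t|pos_reals. of_real (exp (x * ln t) * exp (- (c * t))))"
    by (simp flip: exp_of_real)
  also have "\<dots> = of_real (LINT t|pos_reals. exp (x * ln t) * exp (- (c * t)))"
    by (rule integral_complex_of_real)
  also have "(LINT t|pos_reals. exp (x * ln t) * exp (- (c * t))) = Gamma (x + 1) * c powr (-x-1)"
    by (rule integrable_pos_realsI[OF _ _ nn_integral_powr_exp])
       (use x c in \<open>auto intro: Gamma_real_nonneg\<close>)
  also have "c powr (-x-1) = exp (- (x + 1) * ln c)" using c by (simp add: powr_def algebra_simps)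
  finally show "?l (of_real x) = ?r (of_real x)"
    using Gamma_complex_of_real[of "x + 1"] by (simp flip: exp_of_real)
qed (use s in auto)

text \<open>Write \<open>1 / (t + w)\<^sup>2\<close> as the integral of
  \<open>x * exp (- ((t + w) * x))\<close> over \<open>x > 0\<close> and exchange the integrals by
  Tonelli; two Gamma integrals remain.\<close>

lemma nn_integral_resolvent_real:
  assumes a: "-1 < a" "a < 1" and w: "w > (0::real)"
  shows "(\<integral>\<^sup>+t. ennreal (exp (a * ln t) / (t + w)\<^sup>2) \<partial>pos_reals) =
           ennreal (Gamma (1 + a) * Gamma (1 - a) * w powr (a - 1))"
proof -
  interpret sigma_finite_measure pos_reals
    by (rule sigma_finite_measure_restrict_space) (auto intro: sigma_finite_lborel)
  interpret P: pair_sigma_finite pos_reals pos_reals ..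
  let ?f = "\<lambda>t x. ennreal (exp (a * ln t) * (exp (1 * ln x) * exp (- ((t + w) * x))))"
  have id: "(\<lambda>x. x) \<in> borel_measurable pos_reals"
    by (rule measurable_restrict_space1) simp
  have fs: "fst \<in> borel_measurable (pos_reals \<Otimes>\<^sub>M pos_reals)"
       "snd \<in> borel_measurable (pos_reals \<Otimes>\<^sub>M pos_reals)"
    using measurable_compose[OF measurable_fst id] measurable_compose[OF measurable_snd id] by auto
  have "(\<integral>\<^sup>+t. ennreal (exp (a * ln t) / (t + w)\<^sup>2) \<partial>pos_reals) = (\<integral>\<^sup>+t. \<integral>\<^sup>+x. ?f t x \<partial>pos_reals \<partial>pos_reals)"
  proof (rule nn_integral_cong)
    fix t assume "t \<in> space pos_reals"
    then have t: "t > 0" by simp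
    have "(\<integral>\<^sup>+x. ?f t x \<partial>pos_reals) = ennreal (exp (a * ln t)) * (\<integral>\<^sup>+x. ennreal (exp (1 * ln x) * exp (- ((t + w) * x))) \<partial>pos_reals)"
      by (subst nn_integral_cmult[symmetric])
         (auto simp: ennreal_mult intro!: measurable_restrict_space1)
    also have "(\<integral>\<^sup>+x. ennreal (exp (1 * ln x) * exp (- ((t + w) * x))) \<partial>pos_reals) = ennreal (Gamma 2 * (t + w) powr (-2))"
      using nn_integral_powr_exp[of 1 "t + w"] t w by simp
    also have "Gamma 2 * (t + w) powr (-2) = 1 / (t + w)\<^sup>2"
      using t w Gamma_fact[of 1, where 'a=real] by (simp add: powr_minus divide_inverse)
    finally show "ennreal (exp (a * ln t) / (t + w)\<^sup>2) = (\<integral>\<^sup>+x. ?f t x \<partial>pos_reals)"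
      by (simp flip: ennreal_mult)
  qed
  also have "\<dots> = (\<integral>\<^sup>+x. \<integral>\<^sup>+t. ?f t x \<partial>pos_reals \<partial>pos_reals)"
    by (rule P.Fubini') (use fs in \<open>simp add: case_prod_beta; measurable\<close>)
  also have "\<dots> = (\<integral>\<^sup>+x. ennreal (Gamma (1 + a)) * ennreal (exp (-a * ln x) * exp (- (w * x))) \<partial>pos_reals)"
  proof (rule nn_integral_cong)
    fix x assume "x \<in> space pos_reals"
    then have x: "x > 0" by simp
    have "(\<integral>\<^sup>+t. ?f t x \<partial>pos_reals) = (\<integral>\<^sup>+t. ennreal (x * exp (- (w * x))) * ennreal (exp (a * ln t) * exp (- (x * t))) \<partial>pos_reals)"
      using x by (intro nn_integral_cong) (simp add: algebra_simps flip: ennreal_mult exp_add)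
    also have "\<dots> = ennreal (x * exp (- (w * x))) * (\<integral>\<^sup>+t. ennreal (exp (a * ln t) * exp (- (x * t))) \<partial>pos_reals)"
      by (rule nn_integral_cmult) (auto intro!: measurable_restrict_space1)
    also have "\<dots> = ennreal (x * exp (- (w * x))) * ennreal (Gamma (a + 1) * x powr (-a-1))"
      using x a by (subst nn_integral_powr_exp) auto
    also have "\<dots> = ennreal (x * exp (- (w * x)) * (Gamma (a + 1) * x powr (-a-1)))"
      using x a by (simp add: ennreal_mult Gamma_real_nonneg)
    also have "x * exp (- (w * x)) * (Gamma (a + 1) * x powr (-a-1)) = Gamma (1 + a) * (exp (-a * ln x) * exp (- (w * x)))"
    proof -
      have "x * x powr (-a-1) = x powr -a" using x by (simp add: powr_diff)
      also have "\<dots> = exp (-a * ln x)" using x by (simp add: powr_def)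
      finally show ?thesis by (simp add: mult_ac add_ac)
    qed
    finally show "(\<integral>\<^sup>+t. ?f t x \<partial>pos_reals) = ennreal (Gamma (1 + a)) * ennreal (exp (-a * ln x) * exp (- (w * x)))"
      using a by (simp add: ennreal_mult Gamma_real_nonneg)
  qed
  also have "\<dots> = ennreal (Gamma (1 + a)) * (\<integral>\<^sup>+x. ennreal (exp (-a * ln x) * exp (- (w * x))) \<partial>pos_reals)"
    by (rule nn_integral_cmult) (auto intro!: measurable_restrict_space1)
  also have "\<dots> = ennreal (Gamma (1 + a)) * ennreal (Gamma (-a + 1) * w powr (a - 1))"
    using a w by (subst nn_integral_powr_exp) auto
  also have "\<dots> = ennreal (Gamma (1 + a) * Gamma (1 - a) * w powr (a - 1))"
    using a by (simp add: ennreal_mult Gamma_real_nonneg mult_ac)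
  finally show ?thesis .
qed

lemma integral_resolvent_real:
  assumes a: "-1 < a" "a < 1" and w: "w > (0::real)"
  shows "integrable pos_reals (\<lambda>t. exp (a * ln t) / (t + w)\<^sup>2)"
    and "(LINT t|pos_reals. exp (a * ln t) / (t + w)\<^sup>2) = Gamma (1 + a) * Gamma (1 - a) * w powr (a - 1)"
  using integrable_pos_realsI[OF _ _ nn_integral_resolvent_real[OF assms]] assms
  by (auto simp: Gamma_real_nonneg)

text \<open>Supplies a majorant, uniform for \<open>v\<close> near \<open>w\<close>, for the
  holomorphy of the resolvent integral in \<open>w\<close>. The distance of \<open>w\<close> from
  the slit bounds the norm from below, and the triangle inequality adds the linear growth in
  \<open>t\<close>.\<close>

lemma resolvent_lower_bound:
  fixes w :: complex
  assumes w: "w \<notin> \<real>\<^sub>\<le>\<^sub>0"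
  obtains d c where "d > 0" "c > 0"
    "\<And>v t. v \<in> ball w d \<Longrightarrow> t > 0 \<Longrightarrow> norm (of_real t + v) \<ge> c * (t + 1)"
proof -
  have "open (- \<real>\<^sub>\<le>\<^sub>0 :: complex set)" by (simp add: open_Compl)
  then obtain e where e: "e > 0" "ball w e \<subseteq> - \<real>\<^sub>\<le>\<^sub>0"
    using w unfolding open_contains_ball by blast
  have far: "norm (of_real t + w) \<ge> e" if "t > 0" for t
  proof (rule ccontr)
    assume "\<not> norm (of_real t + w) \<ge> e"
    then have "- of_real t \<in> ball w e" by (simp add: dist_norm add.commute)
    then have "- complex_of_real t \<notin> \<real>\<^sub>\<le>\<^sub>0" using e by blast
    then show False using that by (simp add: complex_nonpos_Reals_iff)
  qed
  \<comment> \<open>With \<open>n = norm (of_real t + v)\<close> it turns out that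
    \<open>t + 1 \<le> n + (norm w + e + 1)\<close> and \<open>n \<ge> e/2\<close>, so the bracket
    is at most \<open>(norm w + e + 1) / (e/2) * n\<close>.\<close>
  define c where "c = inverse (1 + (norm w + e + 1) / (e/2))"
  have "1 + (norm w + e + 1) / (e/2) > 0" using e by (intro add_pos_nonneg divide_nonneg_nonneg) auto
  then have c: "c > 0" by (simp add: c_def)
  show ?thesis
  proof (rule that[of "e/2" c])
    fix v and t :: real assume v: "v \<in> ball w (e/2)" and t: "t > 0"
    let ?n = "norm (of_real t + v)"
    have d: "norm (v - w) < e/2" using v by (simp add: dist_norm norm_minus_commute)
    have "norm (of_real t + w) \<le> ?n + norm (v - w)"
      using norm_triangle_ineq4[of "of_real t + v" "v - w"] by simp
    then have n: "?n \<ge> e/2" using far[OF t] d by linarith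
    have "t \<le> ?n + norm v"
      using norm_triangle_ineq4[of "of_real t + v" v] t by simp
    moreover have "norm v \<le> norm w + e"
      using norm_triangle_ineq[of w "v - w"] d e by simp
    ultimately have "t + 1 \<le> ?n + (norm w + e + 1)" by simp
    also have "norm w + e + 1 = (norm w + e + 1) / (e/2) * (e/2)" using e by simp
    also have "\<dots> \<le> (norm w + e + 1) / (e/2) * ?n"
      using n e by (intro mult_left_mono divide_nonneg_nonneg) auto
    finally have "t + 1 \<le> ?n * (1 + (norm w + e + 1) / (e/2))" by (simp add: algebra_simps)
    then show "c * (t + 1) \<le> ?n"
      using \<open>1 + (norm w + e + 1) / (e/2) > 0\<close> unfolding c_def by (simp add: field_simps)
  qed (use e c in auto)
qed

text \<open>The real formula extends by the identity theorem to the slit plane, where the principal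
  logarithm is holomorphic. It is applied with imaginary \<open>w\<close>, to the terms of a partial
  fraction expansion.\<close>

lemma integral_resolvent:
  fixes w :: complex
  assumes a: "-1 < a" "a < 1" and w: "w \<notin> \<real>\<^sub>\<le>\<^sub>0"
  shows "(LINT t|pos_reals. of_real (exp (a * ln t)) / (of_real t + w)\<^sup>2) =
           of_real (Gamma (1 + a) * Gamma (1 - a)) * exp ((of_real a - 1) * ln w)" (is "?l w = ?r w")
proof (rule holomorphic_eq_if_eq_on_reals[where f = ?l and g = ?r and S = "- \<real>\<^sub>\<le>\<^sub>0" and a = 0 and b = 1])
  show "?r holomorphic_on - \<real>\<^sub>\<le>\<^sub>0" by (intro holomorphic_intros) auto
  show op: "open (- \<real>\<^sub>\<le>\<^sub>0 :: complex set)" by (simp add: open_Compl)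
  have "(\<real>\<^sub>\<le>\<^sub>0 :: complex set) = complex_of_real ` {..0}"
    by (auto simp: nonpos_Reals_def)
  then show "connected (- \<real>\<^sub>\<le>\<^sub>0 :: complex set)"
    using starlike_imp_connected starlike_slotted_complex_plane_left[of 0] by simp
  show "?l holomorphic_on - \<real>\<^sub>\<le>\<^sub>0"
  proof (rule holomorphic_on_parametric_integral[OF op])
    show "(\<lambda>t. complex_of_real (exp (a * ln t)) / (of_real t + z)\<^sup>2) \<in> borel_measurable pos_reals" for z
      by (rule measurable_restrict_space1) measurable
  next
    fix t assume "t \<in> space pos_reals"
    then have "of_real t + z \<noteq> 0" if "z \<notin> \<real>\<^sub>\<le>\<^sub>0" for z :: complex
      using that by (auto simp: add_eq_0_iff complex_nonpos_Reals_iff)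
    then show "(\<lambda>z. complex_of_real (exp (a * ln t)) / (of_real t + z)\<^sup>2) holomorphic_on - \<real>\<^sub>\<le>\<^sub>0"
      by (intro holomorphic_intros) auto
  next
    fix z :: complex assume "z \<in> - \<real>\<^sub>\<le>\<^sub>0"
    then obtain d c where d: "d > 0" "c > 0"
       "\<And>v t. v \<in> ball z d \<Longrightarrow> t > 0 \<Longrightarrow> norm (of_real t + v) \<ge> c * (t + 1)"
      using resolvent_lower_bound by blast
    let ?g = "\<lambda>t. 1 / c\<^sup>2 * (exp (a * ln t) / (t + 1)\<^sup>2)"
    have "norm (complex_of_real (exp (a * ln t)) / (of_real t + v)\<^sup>2) \<le> ?g t"
      if "v \<in> ball z d" "t > 0" for v t
    proof -
      have "(c * (t + 1))\<^sup>2 \<le> (norm (of_real t + v))\<^sup>2"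
        using d(3)[OF that] d(2) that(2) by (intro power_mono) auto
      then have "exp (a * ln t) / (norm (of_real t + v))\<^sup>2 \<le> exp (a * ln t) / (c * (t + 1))\<^sup>2"
        using d(2) that(2) by (intro frac_le) auto
      then show ?thesis by (simp add: norm_divide norm_power power_mult_distrib)
    qed
    moreover have "integrable pos_reals ?g"
      using integral_resolvent_real(1)[OF a, of 1] by (intro integrable_mult_right) auto
    ultimately show "\<exists>r g. r > 0 \<and> integrable pos_reals g \<and> (\<forall>v\<in>ball z r \<inter> - \<real>\<^sub>\<le>\<^sub>0.
        \<forall>t\<in>space pos_reals. norm (complex_of_real (exp (a * ln t)) / (of_real t + v)\<^sup>2) \<le> g t)"
      using d(1) by (intro exI[of _ d] exI[of _ ?g]) auto
  qed
  fix x :: real assume x: "0 < x" "x < 1"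
  have "?l (of_real x) = (LINT t|pos_reals. of_real (exp (a * ln t) / (t + x)\<^sup>2))" by simp
  also have "\<dots> = of_real (LINT t|pos_reals. exp (a * ln t) / (t + x)\<^sup>2)"
    by (rule integral_complex_of_real)
  also have "\<dots> = of_real (Gamma (1 + a) * Gamma (1 - a) * x powr (a - 1))"
    by (subst integral_resolvent_real(2)) (use a x in auto)
  finally show "?l (of_real x) = ?r (of_real x)"
    using x by (simp add: powr_def Ln_of_real flip: exp_of_real)
qed (use w in \<open>auto simp: complex_nonpos_Reals_iff\<close>)

text \<open>Since \<open>(t + |b|)\<^sup>2 \<le> 2 * (t\<^sup>2 + b\<^sup>2)\<close>, twice the real
  integrand at \<open>|b|\<close> is a majorant. The power of \<open>|b|\<close> makes sums over
  equally spaced poles converge when \<open>a < 0\<close>.\<close>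

lemma resolvent_imaginary_bound:
  fixes b :: real
  assumes a: "-1 < a" "a < 1" and b: "b \<noteq> 0"
  shows "integrable pos_reals (\<lambda>t. of_real (exp (a * ln t)) / (of_real t + \<i> * of_real b)\<^sup>2 :: complex)"
    and "(LINT t|pos_reals. norm (of_real (exp (a * ln t)) / (of_real t + \<i> * of_real b)\<^sup>2 :: complex))
          \<le> 2 * (Gamma (1 + a) * Gamma (1 - a)) * \<bar>b\<bar> powr (a - 1)"
proof -
  let ?f = "\<lambda>t. of_real (exp (a * ln t)) / (of_real t + \<i> * of_real b)\<^sup>2 :: complex"
  let ?g = "\<lambda>t. 2 * (exp (a * ln t) / (t + \<bar>b\<bar>)\<^sup>2)"
  have g: "integrable pos_reals ?g"
    by (intro integrable_mult_right integral_resolvent_real(1)) (use a b in auto)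
  have le: "norm (?f t) \<le> ?g t" if "t > 0" for t
  proof -
    have n: "norm (complex_of_real t + \<i> * of_real b)^2 = t\<^sup>2 + b\<^sup>2" by (simp add: cmod_power2)
    have "(t - \<bar>b\<bar>)\<^sup>2 \<ge> 0" by simp
    then have "(t + \<bar>b\<bar>)\<^sup>2 \<le> 2 * (t\<^sup>2 + b\<^sup>2)" by (simp add: power2_eq_square algebra_simps)
    then have "exp (a * ln t) * (t + \<bar>b\<bar>)\<^sup>2 \<le> exp (a * ln t) * (2 * (t\<^sup>2 + b\<^sup>2))" by (intro mult_left_mono) auto
    moreover have "t\<^sup>2 + b\<^sup>2 > 0" "(t + \<bar>b\<bar>)\<^sup>2 > 0" using that b by (auto intro: add_pos_pos add_pos_nonneg)
    ultimately show ?thesis by (simp add: norm_divide norm_power n field_simps)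
  qed
  have "?f \<in> borel_measurable pos_reals" by (rule measurable_restrict_space1) measurable
  then show f: "integrable pos_reals ?f"
    by (rule Bochner_Integration.integrable_bound[OF g]) (auto intro!: AE_I2 order_trans[OF le])
  have "(LINT t|pos_reals. norm (?f t)) \<le> (LINT t|pos_reals. ?g t)"
    using le by (intro integral_mono integrable_norm f g) auto
  also have "\<dots> = 2 * (LINT t|pos_reals. exp (a * ln t) / (t + \<bar>b\<bar>)\<^sup>2)"
    by (rule integral_mult_right_zero)
  also have "\<dots> = 2 * (Gamma (1 + a) * Gamma (1 - a)) * \<bar>b\<bar> powr (a - 1)"
    by (subst integral_resolvent_real(2)) (use a b in auto)
  finally show "(LINT t|pos_reals. norm (?f t)) \<le> 2 * (Gamma (1 + a) * Gamma (1 - a)) * \<bar>b\<bar> powr (a - 1)" .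
qed

text \<open>The logarithmic derivative of the reflection formula of \<open>Gamma\<close> is a
  cotangent identity for \<open>Digamma\<close>; differentiating once more gives the claim.\<close>

lemma Polygamma_1_reflection:
  fixes z :: complex
  assumes z: "z \<notin> \<int>"
  shows "Polygamma 1 z + Polygamma 1 (1 - z) = of_real pi ^ 2 / sin (of_real pi * z) ^ 2"
proof -
  have nz: "w \<notin> \<int>\<^sub>\<le>\<^sub>0" "1 - w \<notin> \<int>\<^sub>\<le>\<^sub>0" "sin (of_real pi * w) \<noteq> 0" if "w \<notin> \<int>" for w :: complex
  proof -
    have "w \<in> \<int>" if "1 - w \<in> \<int>" using Ints_diff[OF Ints_1 that] by simp
    then show "w \<notin> \<int>\<^sub>\<le>\<^sub>0" "1 - w \<notin> \<int>\<^sub>\<le>\<^sub>0" using that nonpos_Ints_Int by blast+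
    show "sin (of_real pi * w) \<noteq> 0"
      using Gamma_reflection_complex[of w] \<open>w \<notin> \<int>\<^sub>\<le>\<^sub>0\<close> \<open>1 - w \<notin> \<int>\<^sub>\<le>\<^sub>0\<close> by (auto simp: Gamma_eq_zero_iff)
  qed
  have op: "open (- \<int> :: complex set)" using closed_Ints by (simp add: open_Compl)
  have dig: "Digamma w - Digamma (1 - w) = - of_real pi * cos (of_real pi * w) / sin (of_real pi * w)"
    if w: "w \<notin> \<int>" for w :: complex
  proof -
    note n = nz[OF w]
    have "((\<lambda>w. Gamma w * Gamma (1 - w)) has_field_derivative
            Gamma w * Digamma w * Gamma (1 - w) + Gamma w * (- (Gamma (1 - w) * Digamma (1 - w)))) (at w)"
      using n by (auto intro!: derivative_eq_intros)
    moreover have "((\<lambda>w. of_real pi / sin (of_real pi * w)) has_field_derivative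
            - (of_real pi * (cos (of_real pi * w) * of_real pi)) / (sin (of_real pi * w))\<^sup>2) (at w)"
      using n by (auto intro!: derivative_eq_intros simp: power2_eq_square)
    ultimately have "Gamma w * Digamma w * Gamma (1 - w) + Gamma w * (- (Gamma (1 - w) * Digamma (1 - w)))
       = - (of_real pi * (cos (of_real pi * w) * of_real pi)) / (sin (of_real pi * w))\<^sup>2"
      unfolding Gamma_reflection_complex by (rule DERIV_unique)
    then have "(Gamma w * Gamma (1 - w)) * (Digamma w - Digamma (1 - w)) =
       (of_real pi / sin (of_real pi * w)) * (- of_real pi * cos (of_real pi * w) / sin (of_real pi * w))"
      by (simp add: algebra_simps power2_eq_square)
    moreover have "complex_of_real pi / sin (of_real pi * w) \<noteq> 0" using n by simp
    ultimately show ?thesis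
      unfolding Gamma_reflection_complex by (metis mult_left_cancel)
  qed
  note n = nz[OF z]
  have "((\<lambda>w. Digamma w - Digamma (1 - w)) has_field_derivative Polygamma 1 z + Polygamma 1 (1 - z)) (at z)"
    using n by (auto intro!: derivative_eq_intros)
  moreover have "((\<lambda>w. - of_real pi * cos (of_real pi * w) / sin (of_real pi * w)) has_field_derivative
      of_real pi ^ 2 * (sin (of_real pi * z) ^ 2 + cos (of_real pi * z) ^ 2) / sin (of_real pi * z) ^ 2) (at z)"
    using n by (auto intro!: derivative_eq_intros simp: power2_eq_square field_simps
      simp del: sin_cos_squared_add sin_cos_squared_add2 sin_cos_squared_add3)
  then have "((\<lambda>w. Digamma w - Digamma (1 - w)) has_field_derivative
      of_real pi ^ 2 * (sin (of_real pi * z) ^ 2 + cos (of_real pi * z) ^ 2) / sin (of_real pi * z) ^ 2) (at z)"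
    by (rule has_field_derivative_transform_within_open[OF _ op]) (use z dig in auto)
  ultimately show ?thesis using DERIV_unique by fastforce
qed

text \<open>For \<open>z = \<i> * u / (2 * pi)\<close> the two halves of the series are trigamma
  series at \<open>z\<close> and \<open>1 - z\<close>, to which the reflection formula applies.
  Pairing \<open>k\<close> with \<open>- (k + 1)\<close> runs through all double poles, the integer
  multiples of \<open>2 * pi * \<i>\<close>.\<close>

lemma partial_fractions_exp:
  fixes u :: complex
  assumes u: "Re u \<noteq> 0"
  shows "(\<lambda>k. 1 / (u - 2 * of_real pi * \<i> * of_nat k)\<^sup>2 + 1 / (u + 2 * of_real pi * \<i> * of_nat (Suc k))\<^sup>2)
           sums (exp (- u) / (1 - exp (- u))\<^sup>2)"
proof -
  define z where "z = \<i> * u / (2 * of_real pi)"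
  have zI: "z \<notin> \<int>" using u by (auto simp: z_def complex_is_Int_iff)
  have z0: "z \<noteq> 0" "1 - z \<noteq> 0" using zI by auto
  have u_z: "u = - (2 * of_real pi * \<i>) * z" by (simp add: z_def)
  have "(\<lambda>k. inverse ((z + of_nat k)\<^sup>2)) sums Polygamma 1 z"
    "(\<lambda>k. inverse ((1 - z + of_nat k)\<^sup>2)) sums Polygamma 1 (1 - z)"
    using summable_sums[OF Polygamma_converges'[OF z0(1), of 2]] summable_sums[OF Polygamma_converges'[OF z0(2), of 2]]
    by (simp_all add: Polygamma_def numeral_2_eq_2)
  then have "(\<lambda>k. - (1 / (4 * of_real pi ^ 2)) * (inverse ((z + of_nat k)\<^sup>2) + inverse ((1 - z + of_nat k)\<^sup>2)))
     sums (- (1 / (4 * of_real pi ^ 2)) * (Polygamma 1 z + Polygamma 1 (1 - z)))"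
    by (intro sums_mult sums_add)
  also have "(\<lambda>k. - (1 / (4 * of_real pi ^ 2)) * (inverse ((z + of_nat k)\<^sup>2) + inverse ((1 - z + of_nat k)\<^sup>2))) =
    (\<lambda>k. 1 / (u - 2 * of_real pi * \<i> * of_nat k)\<^sup>2 + 1 / (u + 2 * of_real pi * \<i> * of_nat (Suc k))\<^sup>2)"
  proof
    fix k
    have "(u - 2 * of_real pi * \<i> * of_nat k)\<^sup>2 = - (4 * of_real pi ^ 2) * (z + of_nat k)\<^sup>2"
      "(u + 2 * of_real pi * \<i> * of_nat (Suc k))\<^sup>2 = - (4 * of_real pi ^ 2) * (1 - z + of_nat k)\<^sup>2"
      by (simp_all add: u_z power2_eq_square algebra_simps)
    moreover have "- (1 / c) * (inverse P + inverse Q) = 1 / (- c * P) + 1 / (- c * Q)" for c P Q :: complex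
      by (simp add: divide_inverse distrib_left)
    ultimately show "- (1 / (4 * of_real pi ^ 2)) * (inverse ((z + of_nat k)\<^sup>2) + inverse ((1 - z + of_nat k)\<^sup>2)) =
      1 / (u - 2 * of_real pi * \<i> * of_nat k)\<^sup>2 + 1 / (u + 2 * of_real pi * \<i> * of_nat (Suc k))\<^sup>2"
      by (simp only:)
  qed
  also have "- (1 / (4 * of_real pi ^ 2)) * (Polygamma 1 z + Polygamma 1 (1 - z)) = - 1 / (4 * sin (of_real pi * z) ^ 2)"
    unfolding Polygamma_1_reflection[OF zI] by simp
  also have "sin (of_real pi * z) = (exp (- (u/2)) - exp (u/2)) / (2 * \<i>)"
    by (simp add: sin_exp_eq z_def)
  also have "- 1 / (4 * ((exp (- (u/2)) - exp (u/2)) / (2 * \<i>))\<^sup>2) = 1 / (exp (- (u/2)) - exp (u/2))\<^sup>2"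
    by (simp add: power_divide power_mult_distrib)
  also have "\<dots> = exp (- u) / (1 - exp (- u))\<^sup>2"
  proof -
    have e: "exp (- u) = exp (- (u/2)) ^ 2" by (simp flip: exp_double)
    have "1 - exp (- u) = exp (- (u/2)) * (exp (u/2) - exp (- (u/2)))"
      using exp_minus_inverse[of "u/2"] by (simp add: e right_diff_distrib power2_eq_square mult.commute)
    then have "(1 - exp (- u))\<^sup>2 = exp (- u) * (exp (- (u/2)) - exp (u/2))\<^sup>2"
      by (simp add: e power_mult_distrib power2_commute)
    then show ?thesis by simp
  qed
  finally show ?thesis .
qed

section \<open>Continuation of the periodic zeta function\<close>

lemma summable_shifted_powr:
  assumes "a > 0" "x > (1::real)"
  shows "summable (\<lambda>k. exp (- x * ln (real k + a)))"
proof (rule summable_comparison_test')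
  show "summable (\<lambda>k. real k powr (-x))" using assms by (simp add: summable_real_powr_iff)
  fix k :: nat assume "k \<ge> 1"
  then have "ln (real k) \<le> ln (real k + a)" using assms by simp
  then have "- x * ln (real k + a) \<le> - x * ln (real k)"
    using assms by (intro mult_left_mono_neg) auto
  then show "norm (exp (- x * ln (real k + a))) \<le> real k powr (-x)"
    using \<open>k \<ge> 1\<close> by (simp add: powr_def)
qed

definition hurwitz_series :: "real \<Rightarrow> complex \<Rightarrow> complex" where
  "hurwitz_series a s = (\<Sum>k. exp (- s * of_real (ln (real k + a))))"

lemma summable_hurwitz_series:
  assumes "a > 0" "Re s > 1"
  shows "summable (\<lambda>k. norm (exp (- s * of_real (ln (real k + a)))))"
  using summable_shifted_powr[OF assms] by simp

lemma holomorphic_hurwitz_series: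
  assumes a: "a > 0"
  shows "hurwitz_series a holomorphic_on {s. Re s > 1}"
proof -
  let ?f = "\<lambda>k (s::complex). exp (- s * of_real (ln (real k + a)))"
  have op: "open {s. Re s > 1}" by (rule open_halfspace_Re_gt)
  obtain g where g: "\<forall>x\<in>{s. Re s > 1}. (\<lambda>n. ?f n x) sums g x \<and> g field_differentiable at x"
  proof (rule series_differentiable_comparison_complex[OF op, of ?f])
    show "?f n field_differentiable at x" for n x
      by (rule holomorphic_on_imp_differentiable_at[of _ UNIV]) (auto intro!: holomorphic_intros)
    fix z assume z: "z \<in> {s. Re s > 1}"
    define d where "d = (Re z - 1) / 2"
    have d: "d > 0" using z by (simp add: d_def)
    let ?h = "\<lambda>k. complex_of_real (exp (- (1 + d) * ln (real k + a)))"
    \<comment> \<open>The term \<open>k = 0\<close> is excluded: \<open>ln a\<close> is negative for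
      \<open>a < 1\<close>, which reverses the comparison.\<close>
    have "\<forall>y\<in>ball z d \<inter> {s. Re s > 1}. norm (?f k y) \<le> norm (?h k)" if k: "k \<ge> 1" for k
    proof
      fix y assume "y \<in> ball z d \<inter> {s. Re s > 1}"
      then have "\<bar>Re z - Re y\<bar> < d" using abs_Re_le_cmod[of "z - y"] by (simp add: dist_norm)
      then have "1 + d \<le> Re y" unfolding d_def abs_less_iff by (simp add: field_simps)
      moreover have "ln (real k + a) \<ge> 0" using k a by simp
      ultimately have "(1 + d) * ln (real k + a) \<le> Re y * ln (real k + a)" by (rule mult_right_mono)
      then show "norm (?f k y) \<le> norm (?h k)" by (simp add: algebra_simps)
    qed
    then have "\<forall>\<^sub>F k in sequentially. \<forall>y\<in>ball z d \<inter> {s. Re s > 1}. norm (?f k y) \<le> norm (?h k)"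
      by (rule eventually_sequentiallyI)
    moreover have "summable ?h"
      using summable_shifted_powr[OF a, of "1 + d"] d by (intro summable_of_real) auto
    moreover have "range ?h \<subseteq> \<real>\<^sub>\<ge>\<^sub>0" by auto
    ultimately show "\<exists>d (h :: nat \<Rightarrow> complex). 0 < d \<and> summable h \<and> range h \<subseteq> \<real>\<^sub>\<ge>\<^sub>0 \<and>
        (\<forall>\<^sub>F n in sequentially. \<forall>y\<in>ball z d \<inter> {s. Re s > 1}. norm (?f n y) \<le> norm (h n))"
      using d by (intro exI[of _ d] exI[of _ ?h] conjI)
  qed auto
  have "g holomorphic_on {s. Re s > 1}"
    using g by (auto simp: holomorphic_on_def intro: field_differentiable_at_within)
  then show ?thesis
    by (rule holomorphic_transform) (use g in \<open>auto simp: hurwitz_series_def sums_iff\<close>)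
qed

text \<open>For \<open>t > 0\<close> this is the closed form of the series \<open>E(t)\<close>, the
  sum of \<open>n * w ^ n\<close>. Unlike the series, it can be estimated directly as
  \<open>t\<close> tends to 0.\<close>

definition bose_kernel :: "real \<Rightarrow> real \<Rightarrow> complex" where
  "bose_kernel a t = (let w = exp (- (of_real t - 2 * of_real pi * \<i> * of_real a)) in w / (1 - w)\<^sup>2)"

lemma bose_kernel_measurable [measurable]: "bose_kernel a \<in> borel_measurable borel"
  unfolding bose_kernel_def Let_def by measurable

text \<open>\<open>\<omega>\<close> has norm 1 and differs from 1, so the segment from 0 to
  \<open>\<omega>\<close> misses 1 and, by compactness, keeps a positive distance from it. Hence the
  kernel stays bounded as \<open>t\<close> tends to 0, which lets its Mellin transform reach
  \<open>Re s > -1\<close>.\<close>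

lemma bose_kernel_bound:
  assumes a: "0 < a" "a < 1"
  obtains C where "\<And>t. t > 0 \<Longrightarrow> norm (bose_kernel a t) \<le> C * exp (- (1 * t))"
proof -
  define \<omega> where "\<omega> = exp (2 * of_real pi * \<i> * of_real a)"
  have n\<omega>: "norm \<omega> = 1" by (simp add: \<omega>_def)
  have \<omega>: "\<omega> \<noteq> 1"
  proof
    assume "\<omega> = 1"
    then obtain n :: int where "2 * pi * a = of_int (2 * n) * pi"
      by (auto simp: \<omega>_def exp_eq_1)
    then have "a = of_int n" by (simp add: field_simps)
    with a show False by simp
  qed
  have nz: "1 - of_real x * \<omega> \<noteq> 0" if "x \<in> {0..1}" for x :: real
  proof
    assume *: "1 - of_real x * \<omega> = 0"
    then have "norm (of_real x * \<omega>) = 1" by simp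
    then have "x = 1" using that n\<omega> by (simp add: norm_mult)
    with * \<omega> show False by simp
  qed
  have "continuous_on {0..1} (\<lambda>x::real. norm (1 - of_real x * \<omega>))" by (intro continuous_intros)
  then obtain x0 :: real where x0: "x0 \<in> {0..1}"
    "\<And>x. x \<in> {0..1} \<Longrightarrow> norm (1 - of_real x0 * \<omega>) \<le> norm (1 - of_real x * \<omega>)"
    using continuous_attains_inf[of "{0..1::real}" "\<lambda>x. norm (1 - of_real x * \<omega>)"] by auto
  define c where "c = norm (1 - of_real x0 * \<omega>)"
  have c: "c > 0" using nz[OF x0(1)] by (simp add: c_def)
  show ?thesis
  proof (rule that)
    fix t :: real assume t: "t > 0"
    have w: "exp (- (of_real t - 2 * of_real pi * \<i> * of_real a)) = of_real (exp (-t)) * \<omega>"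
      by (simp add: \<omega>_def exp_diff exp_minus field_simps exp_of_real)
    have "c \<le> norm (1 - of_real (exp (-t)) * \<omega>)" unfolding c_def using t by (intro x0(2)) auto
    then have "c\<^sup>2 \<le> (norm (1 - of_real (exp (-t)) * \<omega>))\<^sup>2" using c by (intro power_mono) auto
    then have "exp (-t) / (norm (1 - of_real (exp (-t)) * \<omega>))\<^sup>2 \<le> exp (-t) / c\<^sup>2"
      using c by (intro frac_le) auto
    then show "norm (bose_kernel a t) \<le> (1 / c\<^sup>2) * exp (- (1 * t))"
      unfolding bose_kernel_def w Let_def by (simp add: norm_divide norm_mult norm_power n\<omega>)
  qed
qed

text \<open>
  \<open>periodic_zeta_right\<close> is meaningful for \<open>Re s > -1\<close> only, \<open>periodic_zeta_left\<close> for \<open>Re s < 0\<close> only.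
\<close>
definition periodic_zeta_right :: "real \<Rightarrow> complex \<Rightarrow> complex" where
  "periodic_zeta_right a s =
     rGamma (s + 1) * (LINT t|pos_reals. exp (s * of_real (ln t)) * bose_kernel a t)"

definition periodic_zeta_left :: "real \<Rightarrow> complex \<Rightarrow> complex" where
  "periodic_zeta_left a s = Gamma (1 - s) * exp ((s - 1) * of_real (ln (2 * pi))) *
     (exp (- (\<i> * of_real pi * (s - 1) / 2)) * hurwitz_series a (1 - s) +
      exp (\<i> * of_real pi * (s - 1) / 2) * hurwitz_series (1 - a) (1 - s))"

lemma holomorphic_periodic_zeta_right:
  assumes a: "0 < a" "a < 1"
  shows "periodic_zeta_right a holomorphic_on {s. Re s > -1}"
proof -
  obtain C where "\<And>t. t > 0 \<Longrightarrow> norm (bose_kernel a t) \<le> C * exp (- (1 * t))"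
    using bose_kernel_bound[OF a] by blast
  from mellin_exponential_decay(1)[OF bose_kernel_measurable zero_less_one this] show ?thesis
    unfolding periodic_zeta_right_def by (intro holomorphic_intros)
qed

lemma holomorphic_periodic_zeta_left:
  assumes a: "0 < a" "a < 1"
  shows "periodic_zeta_left a holomorphic_on {s. Re s < 0}"
proof -
  have "1 - s \<notin> \<int>\<^sub>\<le>\<^sub>0" if "Re s < 0" for s
    using that by (auto elim!: nonpos_Ints_cases simp: complex_eq_iff)
  moreover have "(\<lambda>s. hurwitz_series b (1 - s)) holomorphic_on {s. Re s < 0}" if "b > 0" for b
  proof -
    have "(\<lambda>s::complex. 1 - s) holomorphic_on {s. Re s < 0}" by (intro holomorphic_intros)
    from holomorphic_on_compose_gen[OF this holomorphic_hurwitz_series[OF that]] show ?thesis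
      by (auto simp: o_def image_subset_iff)
  qed
  ultimately show ?thesis
    unfolding periodic_zeta_left_def using a by (intro holomorphic_intros) auto
qed

text \<open>Termwise integration of the power series of the kernel; each Mellin integral is
  \<open>Gamma (s + 1)\<close> times a Dirichlet term. The integrals of the norms decay like the
  power \<open>- Re s\<close> of the index, hence are summable.\<close>

lemma periodic_zeta_right_sums:
  assumes a: "0 < a" "a < 1" and s: "Re s > 1"
  shows "(\<lambda>n. exp (2 * of_real pi * \<i> * of_real a * of_nat (Suc n)) * exp (- s * of_real (ln (real (Suc n)))))
           sums periodic_zeta_right a s"
proof -
  let ?e = "\<lambda>n. exp (2 * of_real pi * \<i> * of_real a * of_nat (Suc n))"
  let ?f = "\<lambda>n t. of_nat (Suc n) * ?e n * (exp (s * of_real (ln t)) * of_real (exp (- (real (Suc n) * t))))"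
  have s1: "Re s > -1" using s by simp
  have norm_f: "norm (?f n t) = real (Suc n) * (exp (Re s * ln t) * exp (- (real (Suc n) * t)))" for n t
    by (simp add: norm_mult del: of_nat_Suc)
  have int: "integrable pos_reals (\<lambda>t. exp (s * complex_of_real (ln t)) * of_real (exp (- (real (Suc n) * t))))" for n
    by (rule mellin_exponential_decay(2)[where C = 1 and c = "real (Suc n)"]) (use s1 in auto)
  have "(\<lambda>n. integral\<^sup>L pos_reals (?f n)) sums (LINT t|pos_reals. (\<Sum>n. ?f n t))"
  proof (rule sums_integral)
    show "integrable pos_reals (?f n)" for n
      by (intro integrable_mult_right int)
    show "AE t in pos_reals. summable (\<lambda>n. norm (?f n t))"
    proof (rule AE_I2)
      fix t assume "t \<in> space pos_reals"
      then have t: "t > 0" by simp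
      have "summable (\<lambda>n. of_nat (Suc n) * exp (-t) ^ n)"
        using geometric_deriv_sums[of "exp (-t)"] t by (auto simp: sums_iff)
      then have "summable (\<lambda>n. exp (Re s * ln t) * exp (-t) * (of_nat (Suc n) * exp (-t) ^ n))"
        by (rule summable_mult)
      moreover have "exp (- (real (Suc n) * t)) = exp (-t) * exp (-t) ^ n" for n
        using exp_of_nat_mult[of "Suc n" "-t"] by simp
      ultimately show "summable (\<lambda>n. norm (?f n t))"
        unfolding norm_f by (simp only: mult_ac)
    qed
    have "(LINT t|pos_reals. norm (?f n t)) = Gamma (Re s + 1) * exp (- Re s * ln (real n + 1))" for n
    proof -
      have "(LINT t|pos_reals. norm (?f n t)) = real (Suc n) * (LINT t|pos_reals. exp (Re s * ln t) * exp (- (real (Suc n) * t)))"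
        unfolding norm_f by (rule integral_mult_right_zero)
      also have "(LINT t|pos_reals. exp (Re s * ln t) * exp (- (real (Suc n) * t))) = Gamma (Re s + 1) * real (Suc n) powr (- Re s - 1)"
        by (rule integrable_pos_realsI[OF _ _ nn_integral_powr_exp]) (use s1 in \<open>auto intro: Gamma_real_nonneg\<close>)
      also have "real (Suc n) powr (- Re s - 1) = real (Suc n) powr (- Re s) / real (Suc n)"
        by (simp add: powr_diff del: of_nat_Suc)
      also have "real (Suc n) powr (- Re s) = exp (- Re s * ln (real (Suc n)))"
        by (simp add: powr_def del: of_nat_Suc)
      finally show ?thesis by (simp add: add_ac)
    qed
    then show "summable (\<lambda>n. LINT t|pos_reals. norm (?f n t))"
      using summable_shifted_powr[of 1 "Re s"] s by (simp add: summable_mult)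
  qed
  moreover have "(LINT t|pos_reals. (\<Sum>n. ?f n t)) = (LINT t|pos_reals. exp (s * of_real (ln t)) * bose_kernel a t)"
  proof (rule Bochner_Integration.integral_cong[OF refl])
    fix t assume "t \<in> space pos_reals"
    then have t: "t > 0" by simp
    define w where "w = exp (- (of_real t - 2 * of_real pi * \<i> * of_real a))"
    have "norm w < 1" using t by (simp add: w_def)
    then have "(\<lambda>n. exp (s * of_real (ln t)) * w * (of_nat (Suc n) * w ^ n)) sums (exp (s * of_real (ln t)) * w * (1 / (1 - w)\<^sup>2))"
      by (intro sums_mult geometric_deriv_sums)
    moreover have "exp (s * of_real (ln t)) * w * (of_nat (Suc n) * w ^ n) = ?f n t" for n
    proof -
      have "w * w ^ n = exp (of_nat (Suc n) * (- (of_real t - 2 * of_real pi * \<i> * of_real a)))"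
        unfolding w_def exp_of_nat_mult by simp
      also have "\<dots> = exp (2 * of_real pi * \<i> * of_real a * of_nat (Suc n) + of_real (- (real (Suc n) * t)))"
        by (rule arg_cong[where f = exp]) (simp add: algebra_simps)
      also have "\<dots> = ?e n * of_real (exp (- (real (Suc n) * t)))"
        by (simp only: exp_add exp_of_real)
      finally show ?thesis by (simp add: mult_ac)
    qed
    ultimately have "(\<lambda>n. ?f n t) sums (exp (s * of_real (ln t)) * w * (1 / (1 - w)\<^sup>2))"
      by (simp only:)
    also have "exp (s * of_real (ln t)) * w * (1 / (1 - w)\<^sup>2) = exp (s * of_real (ln t)) * bose_kernel a t"
      unfolding bose_kernel_def Let_def w_def[symmetric] by simp
    finally show "(\<Sum>n. ?f n t) = exp (s * of_real (ln t)) * bose_kernel a t"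
      by (rule sums_unique[symmetric])
  qed
  moreover have "integral\<^sup>L pos_reals (?f n) = Gamma (s + 1) * (?e n * exp (- s * of_real (ln (real (Suc n)))))" for n
  proof -
    have "integral\<^sup>L pos_reals (?f n) = of_nat (Suc n) * ?e n * (Gamma (s + 1) * exp (- (s + 1) * of_real (ln (real (Suc n)))))"
      by (subst integral_mult_right_zero, subst mellin_exp) (use s1 in auto)
    also have "exp (- (s + 1) * of_real (ln (real (Suc n)))) = exp (- s * of_real (ln (real (Suc n)))) / of_real (exp (ln (real (Suc n))))"
    proof -
      have "- (s + 1) * complex_of_real y = - s * of_real y - of_real y" for y by (simp add: algebra_simps)
      then show ?thesis by (simp only: exp_diff exp_of_real)
    qed
    also have "complex_of_real (exp (ln (real (Suc n)))) = of_nat (Suc n)" by simp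
    finally show ?thesis by (simp add: mult_ac del: of_nat_Suc)
  qed
  ultimately have "(\<lambda>n. Gamma (s + 1) * (?e n * exp (- s * of_real (ln (real (Suc n)))))) sums
     (LINT t|pos_reals. exp (s * of_real (ln t)) * bose_kernel a t)"
    by (simp only:)
  from sums_mult[OF this, of "rGamma (s + 1)"]
  have "(\<lambda>n. rGamma (s + 1) * (Gamma (s + 1) * (?e n * exp (- s * of_real (ln (real (Suc n))))))) sums
     periodic_zeta_right a s"
    unfolding periodic_zeta_right_def .
  moreover have "s + 1 \<notin> \<int>\<^sub>\<le>\<^sub>0" using s by (intro Re_pos_notin_nonpos_Ints) simp
  then have "rGamma (s + 1) * (Gamma (s + 1) * x) = x" for x
    by (simp add: rGamma_inverse_Gamma Gamma_eq_zero_iff)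
  ultimately show ?thesis by (simp only:)
qed

text \<open>The principal arguments \<open>pi/2\<close> and \<open>- pi/2\<close> are the source of
  the two exponential factors in \<open>periodic_zeta_left\<close>.\<close>

lemma Ln_imaginary:
  assumes "b > 0"
  shows "Ln (\<i> * of_real b) = of_real (ln b) + \<i> * of_real (pi / 2)"
    and "Ln (- (\<i> * of_real b)) = of_real (ln b) - \<i> * of_real (pi / 2)"
proof -
  have i: "exp (\<i> * of_real (pi / 2)) = \<i>" by (simp only: cis_conv_exp[symmetric] cis_pi_half)
  have "exp (of_real (ln b) + \<i> * of_real (pi / 2)) = \<i> * of_real b"
    using assms by (simp only: exp_add exp_of_real i) simp
  moreover have "exp (of_real (ln b) - \<i> * of_real (pi / 2)) = - (\<i> * of_real b)"
    using assms by (simp only: exp_diff exp_of_real i) simp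
  ultimately show "Ln (\<i> * of_real b) = of_real (ln b) + \<i> * of_real (pi / 2)"
    and "Ln (- (\<i> * of_real b)) = of_real (ln b) - \<i> * of_real (pi / 2)"
    using pi_gt_zero by (auto intro!: Ln_unique intro: order_trans[of _ 0])
qed

text \<open>Termwise integration of the partial fraction expansion of the kernel:
  \<open>x > -1\<close> makes each term integrable at 0, and \<open>x < 0\<close> makes the
  integrals summable over the poles.\<close>

lemma periodic_zeta_agree_real:
  assumes a: "0 < a" "a < 1" and x: "-1 < x" "x < 0"
  shows "periodic_zeta_right a (of_real x) = periodic_zeta_left a (of_real x)"
proof -
  \<comment> \<open>The poles of the kernel in \<open>t\<close> are \<open>\<i> * b k\<close> and
    \<open>- \<i> * c k\<close>; hence the arguments \<open>- b k\<close> and \<open>c k\<close> of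
    \<open>f\<close> below.\<close>
  define b c where "b = (\<lambda>k. 2 * pi * (real k + a))" and "c = (\<lambda>k. 2 * pi * (real k + (1 - a)))"
  have pos: "b k > 0" "c k > 0" for k using a by (auto simp: b_def c_def intro!: mult_pos_pos add_nonneg_pos)
  define f where "f = (\<lambda>d t. complex_of_real (exp (x * ln t)) / (of_real t + \<i> * of_real d)\<^sup>2)"
  define K where "K = Gamma (1 + x) * Gamma (1 - x)"
  have int: "integrable pos_reals (f d)" if "d \<noteq> 0" for d
    unfolding f_def using resolvent_imaginary_bound(1)[of x d] x that by simp
  have bnd: "(LINT t|pos_reals. norm (f d t)) \<le> 2 * K * \<bar>d\<bar> powr (x - 1)" if "d \<noteq> 0" for d
    unfolding f_def K_def using resolvent_imaginary_bound(2)[of x d] x that by simp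
  have sum_powr: "summable (\<lambda>k. (2 * pi * (real k + d)) powr (y - 1))" if "d > 0" "y < 0" for d y
  proof -
    have "summable (\<lambda>k. (2 * pi) powr (y - 1) * exp (- (1 - y) * ln (real k + d)))"
      by (intro summable_mult summable_shifted_powr) (use that in auto)
    moreover have "(2 * pi) powr (y - 1) * exp (- (1 - y) * ln (real k + d)) = (2 * pi * (real k + d)) powr (y - 1)" for k
      using that by (subst powr_mult) (auto simp: powr_def)
    ultimately show ?thesis by (simp only:)
  qed
  let ?F = "\<lambda>k t. f (- b k) t + f (c k) t"
  have "(\<lambda>k. integral\<^sup>L pos_reals (?F k)) sums (LINT t|pos_reals. (\<Sum>k. ?F k t))"
  proof (rule sums_integral)
    show "integrable pos_reals (?F k)" for k
      using pos[of k] by (intro Bochner_Integration.integrable_add int) auto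
    show "AE t in pos_reals. summable (\<lambda>k. norm (?F k t))"
    proof (rule AE_I2)
      fix t assume "t \<in> space pos_reals"
      then have t: "t > 0" by simp
      \<comment> \<open>For fixed \<open>t\<close> the inverse square of \<open>d\<close> gives
        summability. After integration over \<open>t\<close> only the power \<open>x - 1\<close> of
        \<open>|d|\<close> is left, which is still summable.\<close>
      have fb: "norm (f d t) \<le> exp (x * ln t) * \<bar>d\<bar> powr (-2)" if "d \<noteq> 0" for d
      proof -
        have "(norm (of_real t + \<i> * of_real d))\<^sup>2 = t\<^sup>2 + d\<^sup>2" by (simp add: cmod_power2)
        then have "norm (f d t) = exp (x * ln t) / (t\<^sup>2 + d\<^sup>2)"
          by (simp add: f_def norm_divide norm_power)
        also have "\<dots> \<le> exp (x * ln t) / d\<^sup>2" using that by (intro frac_le) auto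
        also have "\<dots> = exp (x * ln t) * \<bar>d\<bar> powr (-2)"
          using that by (simp add: powr_minus divide_inverse)
        finally show ?thesis .
      qed
      have "summable (\<lambda>k. exp (x * ln t) * (b k powr (-1 - 1)) + exp (x * ln t) * (c k powr (-1 - 1)))"
        unfolding b_def c_def by (intro summable_add summable_mult sum_powr) (use a in auto)
      then show "summable (\<lambda>k. norm (?F k t))"
      proof (rule summable_comparison_test'[where N = 0])
        fix k
        have "norm (?F k t) \<le> norm (f (- b k) t) + norm (f (c k) t)" by (rule norm_triangle_ineq)
        then show "norm (norm (?F k t)) \<le> exp (x * ln t) * (b k powr (-1 - 1)) + exp (x * ln t) * (c k powr (-1 - 1))"
          using fb[of "- b k"] fb[of "c k"] pos[of k] by simp
      qed
    qed
    show "summable (\<lambda>k. LINT t|pos_reals. norm (?F k t))"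
    proof (rule summable_comparison_test'[where N = 0])
      show "summable (\<lambda>k. 2 * K * (b k powr (x - 1)) + 2 * K * (c k powr (x - 1)))"
        unfolding b_def c_def by (intro summable_add summable_mult sum_powr) (use a x in auto)
      fix k
      have i: "integrable pos_reals (f (- b k))" "integrable pos_reals (f (c k))"
        using pos[of k] by (auto intro!: int)
      have "(LINT t|pos_reals. norm (?F k t)) \<le> (LINT t|pos_reals. norm (f (- b k) t) + norm (f (c k) t))"
        using i by (intro integral_mono) (auto intro: norm_triangle_ineq)
      also have "\<dots> = (LINT t|pos_reals. norm (f (- b k) t)) + (LINT t|pos_reals. norm (f (c k) t))"
        using i by (intro Bochner_Integration.integral_add) auto
      also have "\<dots> \<le> 2 * K * (b k powr (x - 1)) + 2 * K * (c k powr (x - 1))"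
        using bnd[of "- b k"] bnd[of "c k"] pos[of k] by simp
      finally show "norm (LINT t|pos_reals. norm (?F k t)) \<le> 2 * K * (b k powr (x - 1)) + 2 * K * (c k powr (x - 1))"
        by simp
    qed
  qed
  moreover have "(LINT t|pos_reals. (\<Sum>k. ?F k t)) = (LINT t|pos_reals. exp (of_real x * of_real (ln t)) * bose_kernel a t)"
  proof (rule Bochner_Integration.integral_cong[OF refl])
    fix t assume "t \<in> space pos_reals"
    then have t: "t > 0" by simp
    define u where "u = of_real t - 2 * of_real pi * \<i> * of_real a"
    have "Re u \<noteq> 0" using t by (simp add: u_def)
    note sums_mult[OF partial_fractions_exp[OF this], of "exp (of_real x * of_real (ln t))"]
    moreover have "exp (of_real x * of_real (ln t)) *
        (1 / (u - 2 * of_real pi * \<i> * of_nat k)\<^sup>2 + 1 / (u + 2 * of_real pi * \<i> * of_nat (Suc k))\<^sup>2) = ?F k t" for k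
    proof -
      have "u - 2 * of_real pi * \<i> * of_nat k = of_real t + \<i> * of_real (- b k)"
        "u + 2 * of_real pi * \<i> * of_nat (Suc k) = of_real t + \<i> * of_real (c k)"
        by (simp_all add: u_def b_def c_def algebra_simps)
      then show ?thesis by (simp only: f_def) (simp add: exp_of_real[symmetric] distrib_left)
    qed
    ultimately have "(\<lambda>k. ?F k t) sums (exp (of_real x * of_real (ln t)) * (exp (- u) / (1 - exp (- u))\<^sup>2))"
      by (simp only:)
    then show "(\<Sum>k. ?F k t) = exp (of_real x * of_real (ln t)) * bose_kernel a t"
      unfolding bose_kernel_def Let_def u_def[symmetric] by (rule sums_unique[symmetric])
  qed
  moreover define P where "P = exp ((of_real x - 1) * complex_of_real (ln (2 * pi)))"
  define E where "E = exp (\<i> * of_real pi * (complex_of_real x - 1) / 2)"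
  define E' where "E' = exp (- (\<i> * of_real pi * (complex_of_real x - 1) / 2))"
  let ?h = "\<lambda>d k. exp (- (1 - complex_of_real x) * of_real (ln (real k + d)))"
  have "integral\<^sup>L pos_reals (?F k) = of_real K * P * (E' * ?h a k + E * ?h (1 - a) k)" for k
  proof -
    have ln: "ln (b k) = ln (2 * pi) + ln (real k + a)" "ln (c k) = ln (2 * pi) + ln (real k + (1 - a))"
      unfolding b_def c_def using a by (auto intro!: ln_mult_pos mult_pos_pos)
    have nn: "\<i> * of_real (- b k) \<notin> \<real>\<^sub>\<le>\<^sub>0" "\<i> * of_real (c k) \<notin> \<real>\<^sub>\<le>\<^sub>0"
      using pos[of k] by (auto simp: complex_nonpos_Reals_iff)
    have "integral\<^sup>L pos_reals (?F k) = integral\<^sup>L pos_reals (f (- b k)) + integral\<^sup>L pos_reals (f (c k))"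
      using pos[of k] by (intro Bochner_Integration.integral_add int) auto
    also have "integral\<^sup>L pos_reals (f (- b k)) = of_real K * exp ((of_real x - 1) * Ln (\<i> * of_real (- b k)))"
      unfolding f_def K_def using x nn(1) by (intro integral_resolvent) auto
    also have "Ln (\<i> * of_real (- b k)) = of_real (ln (b k)) - \<i> * of_real (pi / 2)"
      using Ln_imaginary(2)[OF pos(1)] by simp
    also have "exp ((of_real x - 1) * (of_real (ln (b k)) - \<i> * of_real (pi / 2))) = P * E' * ?h a k"
      unfolding P_def E'_def exp_add[symmetric] ln by (rule arg_cong[where f = exp]) (simp add: field_simps)
    also have "integral\<^sup>L pos_reals (f (c k)) = of_real K * exp ((of_real x - 1) * Ln (\<i> * of_real (c k)))"
      unfolding f_def K_def using x nn(2) by (intro integral_resolvent) auto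
    also have "Ln (\<i> * of_real (c k)) = of_real (ln (c k)) + \<i> * of_real (pi / 2)"
      by (rule Ln_imaginary(1)[OF pos(2)])
    also have "exp ((of_real x - 1) * (of_real (ln (c k)) + \<i> * of_real (pi / 2))) = P * E * ?h (1 - a) k"
      unfolding P_def E_def exp_add[symmetric] ln by (rule arg_cong[where f = exp]) (simp add: field_simps)
    finally show ?thesis by (simp add: algebra_simps)
  qed
  moreover have "(\<lambda>k. of_real K * P * (E' * ?h a k + E * ?h (1 - a) k)) sums
     (of_real K * P * (E' * hurwitz_series a (1 - of_real x) + E * hurwitz_series (1 - a) (1 - of_real x)))"
  proof -
    have "?h d sums hurwitz_series d (1 - of_real x)" if "d > 0" for d
      unfolding hurwitz_series_def
      by (rule summable_sums[OF summable_norm_cancel[OF summable_hurwitz_series]]) (use that x in auto)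
    then show ?thesis using a by (intro sums_mult sums_add) auto
  qed
  ultimately have eq: "(LINT t|pos_reals. exp (of_real x * of_real (ln t)) * bose_kernel a t) =
     of_real K * P * (E' * hurwitz_series a (1 - of_real x) + E * hurwitz_series (1 - a) (1 - of_real x))"
    using sums_unique2 by (simp only:) blast
  \<comment> \<open>\<open>K\<close> contains \<open>Gamma (1 + x)\<close>, which the reciprocal
    Gamma factor of \<open>periodic_zeta_right\<close> cancels.\<close>
  have "complex_of_real K = Gamma (of_real x + 1) * Gamma (1 - of_real x)"
    using Gamma_complex_of_real[of "1 + x"] Gamma_complex_of_real[of "1 - x"] by (simp add: K_def add_ac)
  moreover have "Gamma (complex_of_real x + 1) \<noteq> 0"
  proof -
    have "Gamma (x + 1) > 0" using x by (intro Gamma_real_pos) auto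
    then show ?thesis using Gamma_complex_of_real[of "x + 1"] by simp
  qed
  ultimately have "rGamma (of_real x + 1) * complex_of_real K = Gamma (1 - of_real x)"
    by (simp add: rGamma_inverse_Gamma)
  then show ?thesis
    unfolding periodic_zeta_right_def periodic_zeta_left_def eq P_def E_def E'_def
    by (simp only: mult.assoc[symmetric])
qed

text \<open>The two half-planes cover the plane and overlap in the strip
  \<open>-1 < Re s < 0\<close>. Agreement on its real segment spreads to the strip by the identity
  theorem, so the two functions glue.\<close>

lemma periodic_zeta_continuation:
  assumes a: "0 < a" "a < 1"
  obtains F where "F holomorphic_on UNIV"
    and "\<And>s. Re s > 1 \<Longrightarrow> (\<lambda>n. exp (2 * of_real pi * \<i> * of_real a * of_nat (Suc n)) *
           exp (- s * of_real (ln (real (Suc n))))) sums F s"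
    and "\<And>s. Re s < 0 \<Longrightarrow> F s = periodic_zeta_left a s"
proof -
  let ?A = "{s. Re s > -1}" and ?B = "{s. Re s < 0}"
  let ?F = "\<lambda>s. if s \<in> ?A then periodic_zeta_right a s else periodic_zeta_left a s"
  have agree: "periodic_zeta_right a s = periodic_zeta_left a s" if "s \<in> ?A" "s \<in> ?B" for s
  proof (rule holomorphic_eq_if_eq_on_reals[where f = "periodic_zeta_right a" and
        g = "periodic_zeta_left a" and S = "?A \<inter> ?B" and a = "-1" and b = 0])
    show "periodic_zeta_right a holomorphic_on ?A \<inter> ?B"
      using holomorphic_periodic_zeta_right[OF a] by (rule holomorphic_on_subset) auto
    show "periodic_zeta_left a holomorphic_on ?A \<inter> ?B"
      using holomorphic_periodic_zeta_left[OF a] by (rule holomorphic_on_subset) auto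
    show "open (?A \<inter> ?B)" by (intro open_Int open_halfspace_Re_gt open_halfspace_Re_lt)
    show "connected (?A \<inter> ?B)"
      by (intro convex_connected convex_Int convex_halfspace_Re_gt convex_halfspace_Re_lt)
    show "periodic_zeta_right a (of_real x) = periodic_zeta_left a (of_real x)" if "-1 < x" "x < 0" for x
      by (rule periodic_zeta_agree_real[OF a that])
  qed (use that in auto)
  show ?thesis
  proof (rule that[of ?F])
    have "?F holomorphic_on (?A \<union> ?B)"
      by (intro holomorphic_on_If_Un holomorphic_periodic_zeta_right holomorphic_periodic_zeta_left a
            open_halfspace_Re_gt open_halfspace_Re_lt agree)
    moreover have "?A \<union> ?B = UNIV" by auto
    ultimately show "?F holomorphic_on UNIV" by simp
  next
    fix s :: complex assume "Re s > 1"
    then show "(\<lambda>n. exp (2 * of_real pi * \<i> * of_real a * of_nat (Suc n)) *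
           exp (- s * of_real (ln (real (Suc n))))) sums ?F s"
      using periodic_zeta_right_sums[OF a] by (simp del: of_nat_Suc)
  next
    fix s :: complex assume "Re s < 0"
    then show "?F s = periodic_zeta_left a s" using agree[of s] by auto
  qed
qed

section \<open>Gauss sums of primitive characters\<close>

definition add_char :: "nat \<Rightarrow> int \<Rightarrow> complex" where
  "add_char q n = exp (2 * of_real pi * \<i> * of_int n / of_nat q)"

lemma add_char_add: "add_char q (m + n) = add_char q m * add_char q n"
  by (simp add: add_char_def add_divide_distrib ring_distribs exp_add)

lemma add_char_0 [simp]: "add_char q 0 = 1"
  by (simp add: add_char_def)

lemma cnj_add_char: "cnj (add_char q n) = add_char q (- n)"
  by (simp add: add_char_def exp_cnj)

lemma add_char_eq_1_iff:
  assumes "q > 0"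
  shows "add_char q n = 1 \<longleftrightarrow> int q dvd n"
proof
  assume "add_char q n = 1"
  then obtain k :: int where "2 * pi * real_of_int n / real q = of_int (2 * k) * pi"
    by (auto simp: add_char_def exp_eq_1)
  then have "real_of_int n = of_int (int q * k)" using assms by (simp add: field_simps)
  then have "n = int q * k" by linarith
  then show "int q dvd n" by simp
next
  assume "int q dvd n"
  then obtain k where "n = int q * k" by auto
  then have "add_char q n = exp (2 * of_int k * of_real pi * \<i>)" using assms by (simp add: add_char_def field_simps)
  also have "\<dots> = 1" by (subst exp_eq_1) auto
  finally show "add_char q n = 1" .
qed

lemma add_char_cong:
  assumes "q > 0" "int q dvd m - n"
  shows "add_char q m = add_char q n"
  using add_char_add[of q "m - n" n] assms by (simp add: add_char_eq_1_iff)

lemma add_char_power: "add_char q (n * int k) = add_char q n ^ k"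
  by (induction k) (simp_all add: add_char_add ring_distribs)

text \<open>Orthogonality: a geometric sum whose ratio is a \<open>q\<close>-th root of unity, equal
  to 1 exactly when \<open>q\<close> divides \<open>n\<close>.\<close>

lemma sum_add_char:
  assumes q: "q > 0"
  shows "(\<Sum>k\<in>{0..<int q}. add_char q (n * k)) = (if int q dvd n then of_nat q else 0)"
proof -
  have "(\<Sum>k\<in>{0..<int q}. add_char q (n * k)) = (\<Sum>k<q. add_char q n ^ k)"
    by (rule sum.reindex_bij_witness[of _ int nat]) (auto simp flip: add_char_power)
  also have "\<dots> = (if int q dvd n then of_nat q else 0)"
  proof (cases "int q dvd n")
    case True
    then have "add_char q n = 1" using q by (simp add: add_char_eq_1_iff)
    then show ?thesis using True by simp
  next
    case False
    then have "add_char q n \<noteq> 1" using q by (simp add: add_char_eq_1_iff)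
    moreover have "add_char q n ^ q = 1"
      using q by (simp add: add_char_eq_1_iff flip: add_char_power)
    ultimately show ?thesis using False by (simp add: geometric_sum)
  qed
  finally show ?thesis .
qed

section \<open>Periodic functions and units modulo q\<close>

lemma periodic_int_mult:
  fixes f :: "int \<Rightarrow> 'a"
  assumes "\<And>a. f (a + p) = f a"
  shows "f (a + p * k) = f a"
proof (induction k rule: int_induct[where k = 0])
  case (step1 i)
  then show ?case using assms[of "a + p * i"] by (simp add: algebra_simps)
next
  case (step2 i)
  then show ?case using assms[of "a + p * (i - 1)"] by (simp add: algebra_simps)
qed auto

lemma periodic_int_cong:
  fixes f :: "int \<Rightarrow> 'a"
  assumes "\<And>a. f (a + p) = f a" "p dvd a - b"
  shows "f a = f b"
proof -
  from assms(2) obtain k where "a - b = p * k" by auto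
  then have "a = b + p * k" by simp
  then show ?thesis using periodic_int_mult[of f p, OF assms(1)] by simp
qed

text \<open>Multiplication by a unit permutes the residues modulo \<open>q\<close>.\<close>

lemma sum_periodic_mult_coprime:
  fixes f :: "int \<Rightarrow> 'a :: comm_monoid_add"
  assumes per: "\<And>a. f (a + int q) = f a" and q: "q > 0" and c: "coprime c (int q)"
  shows "(\<Sum>a\<in>{0..<int q}. f (c * a)) = (\<Sum>a\<in>{0..<int q}. f a)"
proof -
  let ?h = "\<lambda>a. (c * a) mod int q"
  have "inj_on ?h {0..<int q}"
  proof (rule inj_onI)
    fix a b assume ab: "a \<in> {0..<int q}" "b \<in> {0..<int q}" "?h a = ?h b"
    then have "int q dvd c * a - c * b" by (simp add: mod_eq_dvd_iff)
    then have "int q dvd c * (a - b)" by (simp add: algebra_simps)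
    then have "int q dvd a - b" using c by (simp add: coprime_commute coprime_dvd_mult_right_iff)
    then have "a mod int q = b mod int q" by (simp add: mod_eq_dvd_iff)
    then show "a = b" using ab by simp
  qed
  moreover have "?h ` {0..<int q} \<subseteq> {0..<int q}" using q by auto
  ultimately have "bij_betw ?h {0..<int q} {0..<int q}"
    unfolding bij_betw_def by (intro conjI endo_inj_surj) auto
  then have "(\<Sum>a\<in>{0..<int q}. f (?h a)) = (\<Sum>a\<in>{0..<int q}. f a)" by (rule sum.reindex_bij_betw)
  moreover have "f (?h a) = f (c * a)" for a
    by (rule periodic_int_cong[where f = f, OF per]) (simp add: mod_eq_dvd_iff[symmetric])
  ultimately show ?thesis by simp
qed

text \<open>Take for \<open>k\<close> the product of the primes of \<open>q\<close> that do not
  divide \<open>a\<close>. A prime factor of \<open>q\<close> dividing \<open>a\<close> divides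
  neither \<open>d\<close> nor \<open>k\<close>; one not dividing \<open>a\<close> divides
  \<open>k\<close>. Either way it divides exactly one of the two summands.\<close>

lemma coprime_lift:
  fixes a d q :: int
  assumes q: "q \<noteq> 0" and a: "coprime a d"
  obtains k where "coprime (a + d * k) q"
proof -
  define P where "P = {p \<in> prime_factors q. \<not> p dvd a}"
  have fin: "finite P" by (simp add: P_def)
  have "coprime (a + d * \<Prod>P) q"
  proof (rule ccontr)
    assume "\<not> coprime (a + d * \<Prod>P) q"
    then have "\<not> is_unit (gcd (a + d * \<Prod>P) q)" by (simp add: coprime_iff_gcd_eq_1)
    moreover have "gcd (a + d * \<Prod>P) q \<noteq> 0" using q by simp
    ultimately obtain p where "p dvd gcd (a + d * \<Prod>P) q" and p: "prime p"
      using prime_divisor_exists by blast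
    then have pq: "p dvd a + d * \<Prod>P" "p dvd q" by auto
    show False
    proof (cases "p dvd a")
      case True
      then have "p dvd d * \<Prod>P" using pq(1) by (simp add: dvd_add_right_iff)
      moreover have "\<not> p dvd d"
        using True a p by (meson coprime_common_divisor not_prime_unit)
      ultimately have "p dvd \<Prod>P" using p by (simp add: prime_dvd_mult_iff)
      then obtain r where "r \<in> P" "p dvd r" using p fin by (auto simp: prime_dvd_prod_iff)
      then have "p = r" using p by (auto simp: P_def intro: primes_dvd_imp_eq)
      then show False using \<open>r \<in> P\<close> True by (simp add: P_def)
    next
      case False
      then have "p \<in> P" using p pq(2) q by (auto simp: P_def in_prime_factors_iff)
      then have "p dvd \<Prod>P" using fin dvd_prodI[of P p "\<lambda>x. x"] by simp
      then show False using pq(1) False by (simp add: dvd_add_left_iff)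
    qed
  qed
  then show ?thesis by (rule that)
qed

section \<open>Dirichlet characters and their Gauss sums\<close>

context
  fixes q :: nat and \<tau> :: "int \<Rightarrow> complex"
  assumes char: "dirichlet_character q \<tau>"
begin

lemma char_modulus_pos: "q > 0"
  and char_mult: "\<tau> (a * b) = \<tau> a * \<tau> b"
  and char_periodic: "\<tau> (a + int q) = \<tau> a"
  and char_eq_0_iff: "\<tau> a = 0 \<longleftrightarrow> \<not> coprime a (int q)"
  using char unfolding dirichlet_character_def by auto

lemma char_cong: "int q dvd a - b \<Longrightarrow> \<tau> a = \<tau> b"
  by (rule periodic_int_cong[where f = \<tau>, OF char_periodic])

lemma char_1: "\<tau> 1 = 1"
  using char_mult[of 1 1] char_eq_0_iff[of 1] by simp

lemma char_neg_1_square: "\<tau> (-1) * \<tau> (-1) = 1"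
  using char_mult[of "-1" "-1"] char_1 by simp

text \<open>By Euler's theorem the value is a root of unity.\<close>

lemma norm_char:
  assumes "coprime a (int q)"
  shows "norm (\<tau> a) = 1"
proof -
  define b where "b = nat (a mod int q)"
  have b: "int b = a mod int q" using char_modulus_pos by (simp add: b_def)
  have \<tau>b: "\<tau> a = \<tau> (int b)" unfolding b by (rule char_cong) (simp add: mod_eq_dvd_iff[symmetric])
  have "coprime (int b) (int q)" unfolding b using assms char_modulus_pos by simp
  then have "coprime b q" by simp
  then have "[b ^ totient q = 1] (mod q)" by (rule euler_theorem)
  then have "[int (b ^ totient q) = int 1] (mod int q)" by (simp only: cong_int_iff)
  then have "\<tau> (int (b ^ totient q)) = \<tau> 1"
    by (intro char_cong) (simp add: cong_iff_dvd_diff)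
  moreover have "\<tau> (int b ^ k) = \<tau> (int b) ^ k" for k
    by (induction k) (simp_all add: char_1 char_mult)
  ultimately have "\<tau> (int b) ^ totient q = 1" by (simp add: char_1)
  then have "norm (\<tau> (int b)) ^ totient q = 1" by (simp flip: norm_power)
  moreover have "totient q > 0" using char_modulus_pos by simp
  ultimately show ?thesis
    unfolding \<tau>b by (metis norm_ge_zero power_eq_1_iff real_norm_def abs_norm_cancel less_numeral_extra(3))
qed

definition gauss_sum :: "int \<Rightarrow> complex" where
  "gauss_sum m = (\<Sum>a\<in>{0..<int q}. \<tau> a * add_char q (a * m))"

text \<open>The substitution of \<open>c * a\<close> for \<open>a\<close> permutes the residues.
  Keeping \<open>\<tau> c\<close> next to the transformed sum avoids conjugates and
  inverses.\<close>

lemma gauss_sum_mult_coprime: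
  assumes "coprime c (int q)"
  shows "gauss_sum m = \<tau> c * gauss_sum (c * m)"
proof -
  have "(\<Sum>a\<in>{0..<int q}. \<tau> (c * a) * add_char q (c * a * m)) = gauss_sum m"
    unfolding gauss_sum_def
  proof (rule sum_periodic_mult_coprime[OF _ char_modulus_pos assms])
    fix a
    have "add_char q ((a + int q) * m) = add_char q (a * m)"
      by (rule add_char_cong[OF char_modulus_pos]) (simp add: algebra_simps)
    then show "\<tau> (a + int q) * add_char q ((a + int q) * m) = \<tau> a * add_char q (a * m)"
      by (simp add: char_periodic)
  qed
  then show ?thesis by (simp add: gauss_sum_def char_mult sum_distrib_left mult_ac)
qed

lemma gauss_sum_uminus: "gauss_sum (- m) = \<tau> (-1) * gauss_sum m"
  using gauss_sum_mult_coprime[of "-1" "-m"] by simp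

lemma gauss_sum_plus_modulus: "gauss_sum (m + int q) = gauss_sum m"
  unfolding gauss_sum_def
  by (intro sum.cong refl arg_cong2[where f = "(*)"] add_char_cong[OF char_modulus_pos])
     (simp add: algebra_simps)

lemma norm_gauss_sum_coprime:
  assumes "coprime m (int q)"
  shows "norm (gauss_sum m) = norm (gauss_sum 1)"
  using gauss_sum_mult_coprime[OF assms, of 1] norm_char[OF assms] by (simp add: norm_mult)

text \<open>Finite Fourier inversion: with the sum over \<open>r\<close> carried out first,
  orthogonality keeps only the residue of \<open>n\<close>.\<close>

lemma gauss_sum_inversion: "(\<Sum>r\<in>{0..<int q}. gauss_sum (- r) * add_char q (n * r)) = of_nat q * \<tau> n"
proof -
  have q: "q > 0" by (rule char_modulus_pos)
  have "(\<Sum>r\<in>{0..<int q}. gauss_sum (- r) * add_char q (n * r)) =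
     (\<Sum>r\<in>{0..<int q}. \<Sum>a\<in>{0..<int q}. \<tau> a * add_char q ((n - a) * r))"
    unfolding gauss_sum_def sum_distrib_right
    by (intro sum.cong refl) (simp add: algebra_simps flip: add_char_add)
  also have "\<dots> = (\<Sum>a\<in>{0..<int q}. \<tau> a * (\<Sum>r\<in>{0..<int q}. add_char q ((n - a) * r)))"
    by (subst sum.swap) (simp add: sum_distrib_left)
  also have "\<dots> = (\<Sum>a\<in>{0..<int q}. if a = n mod int q then \<tau> n * of_nat q else 0)"
  proof (intro sum.cong refl)
    fix a assume a: "a \<in> {0..<int q}"
    have "int q dvd n - a \<longleftrightarrow> a = n mod int q"
      using a by (auto simp: mod_eq_dvd_iff[symmetric])
    then show "\<tau> a * (\<Sum>r\<in>{0..<int q}. add_char q ((n - a) * r)) = (if a = n mod int q then \<tau> n * of_nat q else 0)"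
      unfolding sum_add_char[OF q] using char_cong[of n a] by auto
  qed
  also have "\<dots> = of_nat q * \<tau> n" using q by (subst sum.delta) auto
  finally show ?thesis .
qed

text \<open>Expanding the conjugated factor leaves an inner sum that is the inversion formula with
  two signs reversed; each reversal costs \<open>\<tau> (-1)\<close>, whose square is 1.\<close>

lemma gauss_sum_Parseval:
  "(\<Sum>m\<in>{0..<int q}. (norm (gauss_sum m))\<^sup>2) = real q * (\<Sum>a\<in>{0..<int q}. (norm (\<tau> a))\<^sup>2)"
proof -
  have q: "q > 0" by (rule char_modulus_pos)
  have "complex_of_real (\<Sum>m\<in>{0..<int q}. (norm (gauss_sum m))\<^sup>2) =
     (\<Sum>m\<in>{0..<int q}. gauss_sum m * cnj (gauss_sum m))"
    by (simp only: of_real_sum complex_norm_square)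
  also have "\<dots> = (\<Sum>m\<in>{0..<int q}. \<Sum>a\<in>{0..<int q}. cnj (\<tau> a) * (gauss_sum m * add_char q (- a * m)))"
    by (intro sum.cong refl, subst (2) gauss_sum_def)
       (simp add: sum_distrib_left cnj_add_char mult_ac)
  also have "\<dots> = (\<Sum>a\<in>{0..<int q}. cnj (\<tau> a) * (\<Sum>m\<in>{0..<int q}. gauss_sum m * add_char q (- a * m)))"
    by (subst sum.swap) (simp add: sum_distrib_left)
  also have "\<dots> = (\<Sum>a\<in>{0..<int q}. cnj (\<tau> a) * (of_nat q * \<tau> a))"
  proof (intro sum.cong refl arg_cong2[where f = "(*)"])
    fix a
    have "(\<Sum>m\<in>{0..<int q}. gauss_sum m * add_char q (- a * m)) =
        \<tau> (-1) * (\<Sum>m\<in>{0..<int q}. gauss_sum (- m) * add_char q (- a * m))"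
      unfolding gauss_sum_uminus sum_distrib_left
      by (simp add: mult.assoc[symmetric] char_neg_1_square)
    also have "\<dots> = of_nat q * (\<tau> (-1) * \<tau> (-1 * a))" unfolding gauss_sum_inversion by simp
    also have "\<dots> = of_nat q * \<tau> a" unfolding char_mult by (simp add: mult.assoc[symmetric] char_neg_1_square)
    finally show "(\<Sum>m\<in>{0..<int q}. gauss_sum m * add_char q (- a * m)) = of_nat q * \<tau> a" .
  qed
  also have "\<dots> = complex_of_real (real q * (\<Sum>a\<in>{0..<int q}. (norm (\<tau> a))\<^sup>2))"
    by (simp only: of_real_mult of_real_sum complex_norm_square sum_distrib_left of_real_of_nat_eq mult_ac)
  finally show ?thesis by (simp only: of_real_eq_iff)
qed

text \<open>Triviality on the units congruent to 1 modulo \<open>d\<close> makes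
  \<open>\<tau>\<close> constant on the units modulo \<open>q\<close> within each class modulo
  \<open>d\<close>. By \<open>coprime_lift\<close> every unit class modulo \<open>d\<close> contains
  such a unit, so \<open>\<tau>\<close> descends to a character modulo \<open>d\<close>.\<close>

lemma induced_by_if_trivial_on_kernel:
  assumes d: "d dvd q"
    and triv: "\<And>c. coprime c (int q) \<Longrightarrow> int d dvd c - 1 \<Longrightarrow> \<tau> c = 1"
  shows "\<exists>\<psi>. induced_by q \<tau> d \<psi>"
proof -
  have q: "q > 0" by (rule char_modulus_pos)
  have d0: "d > 0" using d q by (auto intro: Nat.gr0I)
  have dq: "int d dvd int q" using d by simp
  \<comment> \<open>For \<open>x\<close> inverse to \<open>b'\<close> modulo \<open>q\<close>, both
    \<open>b * x\<close> and \<open>b' * x\<close> are 1 modulo \<open>d\<close>, so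
    \<open>\<tau>\<close> is 1 at both and \<open>\<tau> x\<close> cancels.\<close>
  have same: "\<tau> b = \<tau> b'" if c: "coprime b (int q)" "coprime b' (int q)" "int d dvd b - b'" for b b'
  proof -
    obtain x where x: "[b' * x = 1] (mod int q)" using c(2) cong_solve_coprime_int by blast
    then have xc: "coprime (b' * x) (int q)" by (metis cong_imp_coprime cong_sym coprime_1_left)
    then have xc: "coprime x (int q)" by simp
    have qx: "int q dvd b' * x - 1" using x by (simp add: cong_iff_dvd_diff)
    have "int d dvd (b - b') * x + (b' * x - 1)"
      using c(3) dvd_trans[OF dq qx] by (intro dvd_add dvd_mult2)
    also have "(b - b') * x + (b' * x - 1) = b * x - 1" by (simp add: algebra_simps)
    finally have "int d dvd b * x - 1" .
    then have "\<tau> (b * x) = 1" using c(1) xc by (intro triv) auto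
    moreover have "\<tau> (b' * x) = 1" using dvd_trans[OF dq qx] c(2) xc by (intro triv) auto
    ultimately have "\<tau> b * \<tau> x = \<tau> b' * \<tau> x" by (simp add: char_mult)
    then show ?thesis using xc by (simp add: char_eq_0_iff)
  qed
  define lift where "lift = (\<lambda>a. SOME b. coprime b (int q) \<and> int d dvd b - a)"
  have lift: "coprime (lift a) (int q)" "int d dvd lift a - a" if c: "coprime a (int d)" for a
  proof -
    obtain k where "coprime (a + int d * k) (int q)"
      using coprime_lift[OF _ c, of "int q"] q by auto
    then have "\<exists>b. coprime b (int q) \<and> int d dvd b - a" by (intro exI[of _ "a + int d * k"]) auto
    from someI_ex[OF this] show "coprime (lift a) (int q)" "int d dvd lift a - a"
      by (auto simp: lift_def)
  qed
  define \<psi> where "\<psi> = (\<lambda>a. if coprime a (int d) then \<tau> (lift a) else 0)"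
  have \<psi>: "\<psi> a = \<tau> b" if "coprime a (int d)" "coprime b (int q)" "int d dvd b - a" for a b
  proof -
    have "int d dvd (lift a - a) - (b - a)" using lift(2)[OF that(1)] that(3) by (rule dvd_diff)
    then have "\<tau> (lift a) = \<tau> b" using lift(1)[OF that(1)] that(2) by (intro same) simp_all
    then show ?thesis using that(1) by (simp add: \<psi>_def)
  qed
  have "dirichlet_character d \<psi>"
    unfolding dirichlet_character_def
  proof (intro conjI allI)
    fix a b
    show "\<psi> (a * b) = \<psi> a * \<psi> b"
    proof (cases "coprime a (int d) \<and> coprime b (int d)")
      case True
      then have ab: "coprime a (int d)" "coprime b (int d)" by auto
      have "lift a * lift b - a * b = (lift a - a) * lift b + a * (lift b - b)" by (simp add: algebra_simps)
      moreover have "int d dvd (lift a - a) * lift b + a * (lift b - b)"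
        using lift(2)[OF ab(1)] lift(2)[OF ab(2)] by (intro dvd_add dvd_mult dvd_mult2)
      ultimately have "\<psi> (a * b) = \<tau> (lift a * lift b)"
        using ab lift(1) by (intro \<psi>) auto
      then show ?thesis using ab by (simp add: \<psi>_def char_mult)
    next
      case False
      then show ?thesis by (auto simp: \<psi>_def)
    qed
    show "\<psi> (a + int d) = \<psi> a"
    proof (cases "coprime a (int d)")
      case True
      then have c: "coprime (a + int d) (int d)" by (metis coprime_iff_gcd_eq_1 gcd_add1)
      have "int d dvd (lift a - a) - int d" using lift(2)[OF True] by (rule dvd_diff) simp
      then have "\<psi> (a + int d) = \<tau> (lift a)"
        using c lift(1)[OF True] by (intro \<psi>) (auto simp: algebra_simps)
      then show ?thesis using True by (simp add: \<psi>_def)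
    next
      case False
      then have "\<not> coprime (a + int d) (int d)" by (metis coprime_iff_gcd_eq_1 gcd_add1)
      then show ?thesis using False by (simp add: \<psi>_def)
    qed
    show "(\<psi> a \<noteq> 0) = coprime a (int d)"
      using lift(1)[of a] by (auto simp: \<psi>_def char_eq_0_iff)
  qed (use d0 in auto)
  moreover have "\<tau> a = \<psi> a" if "coprime a (int q)" for a
  proof -
    have "coprime a (int d)" using that dq by (meson coprime_divisors dvd_refl)
    then show ?thesis using that by (intro \<psi>[symmetric]) auto
  qed
  ultimately show ?thesis using d by (auto simp: induced_by_def)
qed

text \<open>Let \<open>g\<close> be the gcd of \<open>m\<close> and \<open>q\<close>, and
  \<open>q = g * d\<close>. For a unit \<open>c\<close> congruent to 1 modulo \<open>d\<close>,
  \<open>c * m\<close> and \<open>m\<close> agree modulo \<open>q\<close>, so a non-zero Gauss sum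
  forces \<open>\<tau> c = 1\<close>. Then \<open>\<tau>\<close> is induced from \<open>d\<close>,
  and primitivity yields \<open>g = 1\<close>.\<close>

lemma gauss_sum_eq_0:
  assumes prim: "\<And>d \<psi>. induced_by q \<tau> d \<psi> \<Longrightarrow> d = q" and m: "\<not> coprime m (int q)"
  shows "gauss_sum m = 0"
proof (rule ccontr)
  assume nz: "gauss_sum m \<noteq> 0"
  have q: "q > 0" by (rule char_modulus_pos)
  define g where "g = nat (gcd m (int q))"
  have g: "int g = gcd m (int q)" by (simp add: g_def)
  have gq: "g dvd q" by (metis g gcd_dvd2 int_dvd_int_iff)
  then obtain d where d: "q = g * d" by auto
  have "\<tau> c = 1" if c: "coprime c (int q)" "int d dvd c - 1" for c
  proof -
    have "int g dvd m" by (simp add: g)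
    then have "int g * int d dvd m * (c - 1)" using c(2) by (rule mult_dvd_mono)
    then have dv: "int q dvd c * m - m" by (simp add: d algebra_simps)
    have "gauss_sum (c * m) = gauss_sum m"
      unfolding gauss_sum_def
    proof (intro sum.cong refl arg_cong2[where f = "(*)"] add_char_cong[OF q])
      fix a
      have "int q dvd a * (c * m - m)" using dv by simp
      then show "int q dvd a * (c * m) - a * m" by (simp add: algebra_simps)
    qed
    then show ?thesis using gauss_sum_mult_coprime[OF c(1), of m] nz by simp
  qed
  then have "\<exists>\<psi>. induced_by q \<tau> d \<psi>" by (intro induced_by_if_trivial_on_kernel) (auto simp: d)
  then have "d = q" using prim by blast
  then have "g = 1" using d q by simp
  then show False using m g by (simp add: coprime_iff_gcd_eq_1)
qed

text \<open>The sums vanish off the units and have constant norm on them, so their squared norms are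
  those of \<open>\<tau>\<close> scaled by that of \<open>gauss_sum 1\<close>; Parseval identifies
  this scale as \<open>q\<close>.\<close>

lemma norm_gauss_sum_le:
  assumes prim: "\<And>d \<psi>. induced_by q \<tau> d \<psi> \<Longrightarrow> d = q"
  shows "norm (gauss_sum m) \<le> sqrt (real q)"
proof -
  have q: "q > 0" by (rule char_modulus_pos)
  have eq_0: "gauss_sum m = 0" if "\<not> coprime m (int q)" for m
    by (rule gauss_sum_eq_0) (use prim that in auto)
  let ?R = "{0..<int q}" and ?\<phi> = "\<Sum>a\<in>{0..<int q}. (norm (\<tau> a))\<^sup>2"
  have "(\<Sum>m\<in>?R. (norm (gauss_sum m))\<^sup>2) = (\<Sum>m\<in>?R. (norm (gauss_sum 1))\<^sup>2 * (norm (\<tau> m))\<^sup>2)"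
  proof (intro sum.cong refl)
    fix m
    show "(norm (gauss_sum m))\<^sup>2 = (norm (gauss_sum 1))\<^sup>2 * (norm (\<tau> m))\<^sup>2"
      using norm_char[of m] norm_gauss_sum_coprime[of m] eq_0[of m] char_eq_0_iff[of m]
      by (cases "coprime m (int q)") auto
  qed
  then have "(norm (gauss_sum 1))\<^sup>2 * ?\<phi> = real q * ?\<phi>"
    by (simp add: gauss_sum_Parseval sum_distrib_left)
  moreover have "?\<phi> > 0"
  proof -
    \<comment> \<open>The residue \<open>1 mod int q\<close> instead of 1 covers the case
      \<open>q = 1\<close>, where 1 lies outside the range.\<close>
    have "(norm (\<tau> (1 mod int q)))\<^sup>2 = 1"
      using char_cong[of "1 mod int q" 1] char_1 by (simp add: mod_eq_dvd_iff[symmetric])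
    moreover have "1 mod int q \<in> ?R" using q by auto
    ultimately show ?thesis by (intro sum_pos2[of _ "1 mod int q"]) auto
  qed
  ultimately have "(norm (gauss_sum 1))\<^sup>2 = real q" by simp
  then have "norm (gauss_sum 1) = sqrt (real q)" by (metis norm_ge_zero real_sqrt_unique)
  then show ?thesis
    using norm_gauss_sum_coprime[of m] eq_0[of m]
    by (cases "coprime m (int q)") auto
qed

end

section \<open>The functional equation and the bound\<close>

text \<open>Since \<open>k + r/q = (q * k + r) / q\<close>, the double sum is
  \<open>q powr x\<close> times a sum over distinct positive integers, the non-multiples of
  \<open>q\<close>; the full series of nonnegative terms bounds it.\<close>

lemma sum_hurwitz_le_zeta:
  assumes q: "q > 0" and x: "x > 1"
  shows "(\<Sum>r\<in>{1..<q}. \<Sum>k. exp (- x * ln (real k + real r / real q))) \<le> real q powr x * zeta_real x"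
proof -
  let ?z = "\<lambda>n. 1 / real (Suc n) powr x"
  have "summable (\<lambda>n. 1 / real n powr x)"
    using x by (simp add: summable_real_powr_iff divide_inverse flip: powr_minus)
  then have sz: "summable ?z" by (subst (asm) summable_Suc_iff[symmetric])
  have summand: "exp (- x * ln (real k + real r / real q)) = real q powr x * ?z (q * k + r - 1)"
    if r: "r \<in> {1..<q}" for k r
  proof -
    have "real k + real r / real q > 0" using r q by (intro add_nonneg_pos) auto
    then have "exp (- x * ln (real k + real r / real q)) = (real k + real r / real q) powr (- x)"
      by (simp add: powr_def)
    also have "\<dots> = (real (q * k + r) / real q) powr (- x)"
      using q by (simp add: field_simps)
    also have "\<dots> = real q powr x / real (q * k + r) powr x"
      by (simp add: powr_divide powr_minus field_simps)
    finally have "exp (- x * ln (real k + real r / real q)) = real q powr x / real (q * k + r) powr x" .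
    moreover have "Suc (q * k + r - 1) = q * k + r" using r by simp
    ultimately show ?thesis by (simp only: mult_1_right times_divide_eq_right)
  qed
  have sum: "summable (\<lambda>k. exp (- x * ln (real k + real r / real q)))" if "r \<in> {1..<q}" for r
    by (rule summable_shifted_powr) (use that x in auto)
  have "(\<Sum>r\<in>{1..<q}. \<Sum>k. exp (- x * ln (real k + real r / real q))) =
        (\<Sum>k. \<Sum>r\<in>{1..<q}. exp (- x * ln (real k + real r / real q)))"
    by (rule suminf_sum[symmetric]) (rule sum)
  also have "\<dots> \<le> real q powr x * zeta_real x"
  proof (rule suminf_le_const)
    show "summable (\<lambda>k. \<Sum>r\<in>{1..<q}. exp (- x * ln (real k + real r / real q)))"
      by (rule summable_sum) (rule sum)
    fix N
    \<comment> \<open>The shift by 1 matches \<open>zeta_real\<close>, whose term at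
      \<open>n\<close> belongs to \<open>Suc n\<close>; as \<open>r \<ge> 1\<close>, the subtraction
      does not truncate.\<close>
    let ?h = "\<lambda>(k, r). q * k + r - 1"
    have inj: "inj_on ?h ({..<N} \<times> {1..<q})"
    proof (rule inj_onI, clarify)
      fix k r k' r' assume r: "r \<in> {1..<q}" "r' \<in> {1..<q}" and eq: "q * k + r - 1 = q * k' + r' - 1"
      have "1 \<le> q * k + r" "1 \<le> q * k' + r'" using r by auto
      with eq have eq: "q * k + r = q * k' + r'" by arith
      then have "(q * k + r) mod q = (q * k' + r') mod q" by simp
      then have "r = r'" using r by simp
      then show "k = k' \<and> r = r'" using eq q by simp
    qed
    have "(\<Sum>k<N. \<Sum>r\<in>{1..<q}. exp (- x * ln (real k + real r / real q))) =
          (\<Sum>(k, r)\<in>{..<N} \<times> {1..<q}. real q powr x * ?z (q * k + r - 1))"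
      by (simp only: sum.cartesian_product[symmetric]) (intro sum.cong refl summand)
    also have "\<dots> = real q powr x * (\<Sum>p\<in>{..<N} \<times> {1..<q}. ?z (?h p))"
      by (simp add: sum_distrib_left case_prod_beta)
    also have "(\<Sum>p\<in>{..<N} \<times> {1..<q}. ?z (?h p)) = (\<Sum>n\<in>?h ` ({..<N} \<times> {1..<q}). ?z n)"
      by (subst sum.reindex[OF inj]) (simp add: o_def)
    also have "\<dots> \<le> zeta_real x"
      unfolding zeta_real_def using sz by (intro sum_le_suminf) auto
    finally show "(\<Sum>k<N. \<Sum>r\<in>{1..<q}. exp (- x * ln (real k + real r / real q))) \<le> real q powr x * zeta_real x"
      by (simp add: mult_left_mono)
  qed
  finally show ?thesis .
qed

lemma norm_hurwitz_series_le:
  assumes "a > 0" "Re s > 1"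
  shows "norm (hurwitz_series a s) \<le> (\<Sum>k. exp (- Re s * ln (real k + a)))"
  unfolding hurwitz_series_def
  using summable_norm[OF summable_hurwitz_series[OF assms]] by simp

text \<open>Fourier inversion under the Dirichlet series gives a finite combination of periodic zeta
  functions. All of them are entire: \<open>r = 0\<close>, which would bring in zeta and its pole,
  drops out because \<open>gauss_sum q \<tau> 0\<close> vanishes for primitive \<open>\<tau>\<close>
  and \<open>q > 1\<close>.\<close>

lemma primitive_dirichlet_L_eq:
  assumes q: "q > 1" and prim: "primitive_dirichlet_character q \<tau>" and s: "Re s < 0"
  shows "dirichlet_L \<tau> s =
    (\<Sum>r\<in>{1..<int q}. gauss_sum q \<tau> (- r) * periodic_zeta_left (of_int r / real q) s) / of_nat q"
proof -
  have char: "dirichlet_character q \<tau>" using prim by (simp add: primitive_dirichlet_character_def)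
  have ind: "d = q" if "induced_by q \<tau> d \<psi>" for d \<psi>
    using prim that by (auto simp: primitive_dirichlet_character_def)
  let ?R = "{1..<int q}" and ?a = "\<lambda>r. real_of_int r / real q"
  have "\<forall>r\<in>?R. \<exists>F. F holomorphic_on UNIV \<and>
     (\<forall>s. Re s > 1 \<longrightarrow> (\<lambda>n. exp (2 * of_real pi * \<i> * of_real (?a r) * of_nat (Suc n)) *
           exp (- s * of_real (ln (real (Suc n))))) sums F s) \<and>
     (\<forall>s. Re s < 0 \<longrightarrow> F s = periodic_zeta_left (?a r) s)"
  proof
    fix r assume "r \<in> ?R"
    then have "0 < ?a r" "?a r < 1" using q by (auto simp: field_simps)
    then show "\<exists>F. F holomorphic_on UNIV \<and>
     (\<forall>s. Re s > 1 \<longrightarrow> (\<lambda>n. exp (2 * of_real pi * \<i> * of_real (?a r) * of_nat (Suc n)) *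
           exp (- s * of_real (ln (real (Suc n))))) sums F s) \<and>
     (\<forall>s. Re s < 0 \<longrightarrow> F s = periodic_zeta_left (?a r) s)"
      by (rule periodic_zeta_continuation) (intro exI conjI allI impI; assumption?)
  qed
  from bchoice[OF this] obtain F where F: "\<And>r. r \<in> ?R \<Longrightarrow> F r holomorphic_on UNIV"
     "\<And>r s. r \<in> ?R \<Longrightarrow> Re s > 1 \<Longrightarrow> (\<lambda>n. exp (2 * of_real pi * \<i> * of_real (?a r) * of_nat (Suc n)) *
           exp (- s * of_real (ln (real (Suc n))))) sums F r s"
     "\<And>r s. r \<in> ?R \<Longrightarrow> Re s < 0 \<Longrightarrow> F r s = periodic_zeta_left (?a r) s"
    by blast
  define L where "L = (\<lambda>s. (\<Sum>r\<in>?R. gauss_sum q \<tau> (- r) * F r s) / of_nat q)"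
  have "L holomorphic_on UNIV"
    unfolding L_def using q by (intro holomorphic_intros F(1)) auto
  then have "L nicely_meromorphic_on UNIV"
    by (intro analytic_on_imp_nicely_meromorphic_on) (simp add: analytic_on_open)
  moreover have "L s = dirichlet_series \<tau> s" if s: "Re s > 1" for s
  proof -
    have "(\<lambda>n. (\<Sum>r\<in>?R. gauss_sum q \<tau> (- r) * (exp (2 * of_real pi * \<i> * of_real (?a r) * of_nat (Suc n)) *
           exp (- s * of_real (ln (real (Suc n)))))) / of_nat q) sums L s"
      unfolding L_def by (intro sums_divide sums_sum sums_mult F(2) s)
    moreover have "(\<Sum>r\<in>?R. gauss_sum q \<tau> (- r) * (exp (2 * of_real pi * \<i> * of_real (?a r) * of_nat (Suc n)) *
           exp (- s * of_real (ln (real (Suc n)))))) / of_nat q = \<tau> (int (Suc n)) / of_nat (Suc n) powr s" for n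
    proof -
      have "(\<Sum>r\<in>?R. gauss_sum q \<tau> (- r) * (exp (2 * of_real pi * \<i> * of_real (?a r) * of_nat (Suc n)) *
           exp (- s * of_real (ln (real (Suc n)))))) =
         (\<Sum>r\<in>?R. gauss_sum q \<tau> (- r) * add_char q (int (Suc n) * r)) * exp (- s * of_real (ln (real (Suc n))))"
        unfolding sum_distrib_right
        by (intro sum.cong refl) (simp add: add_char_def mult_ac del: of_nat_Suc)
      also have "(\<Sum>r\<in>?R. gauss_sum q \<tau> (- r) * add_char q (int (Suc n) * r)) =
          (\<Sum>r\<in>{0..<int q}. gauss_sum q \<tau> (- r) * add_char q (int (Suc n) * r))"
      proof (rule sum.mono_neutral_left)
        have "gauss_sum q \<tau> 0 = 0"
          by (rule gauss_sum_eq_0[OF char]) (use ind q in auto)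
        moreover have "{0..<int q} - ?R \<subseteq> {0}" by auto
        ultimately show "\<forall>r\<in>{0..<int q} - ?R. gauss_sum q \<tau> (- r) * add_char q (int (Suc n) * r) = 0"
          by auto
      qed auto
      also have "\<dots> = of_nat q * \<tau> (int (Suc n))" by (rule gauss_sum_inversion[OF char])
      also have "of_nat q * \<tau> (int (Suc n)) * exp (- s * of_real (ln (real (Suc n)))) =
          of_nat q * \<tau> (int (Suc n)) * (1 / of_nat (Suc n) powr s)"
        by (simp add: powr_def exp_minus divide_inverse Ln_of_nat del: of_nat_Suc)
      finally have "(\<Sum>r\<in>?R. gauss_sum q \<tau> (- r) * (exp (2 * of_real pi * \<i> * of_real (?a r) * of_nat (Suc n)) *
           exp (- s * of_real (ln (real (Suc n)))))) = of_nat q * \<tau> (int (Suc n)) * (1 / of_nat (Suc n) powr s)" .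
      then show ?thesis using q by (simp only:) simp
    qed
    ultimately show ?thesis by (simp only: dirichlet_series_def sums_iff)
  qed
  ultimately have cont: "is_L_continuation \<tau> L" by (simp add: is_L_continuation_def)
  then have "dirichlet_L \<tau> = L"
    unfolding dirichlet_L_def
    by (rule the_equality[where P = "is_L_continuation \<tau>"]) (rule L_continuation_unique[OF _ cont])
  then show ?thesis by (simp add: L_def F(3)[OF _ s])
qed

text \<open>Replacing \<open>s\<close> by \<open>s - 1\<close> divides one exponential by
  \<open>\<i>\<close> and multiplies the other by it. The sum arises for even characters, the
  difference for odd ones.\<close>

lemma exp_root_combination:
  "exp (\<i> * of_real pi * (s - 1) / 2) + exp (- (\<i> * of_real pi * (s - 1) / 2)) = 2 * sin (of_real pi * s / 2)"
  "exp (\<i> * of_real pi * (s - 1) / 2) - exp (- (\<i> * of_real pi * (s - 1) / 2)) = - 2 * \<i> * cos (of_real pi * s / 2)"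
proof -
  define w where "w = exp (\<i> * (of_real pi * s / 2))"
  define v where "v = exp (- (\<i> * (of_real pi * s / 2)))"
  have i: "exp (\<i> * of_real (pi / 2)) = \<i>" by (simp only: cis_conv_exp[symmetric] cis_pi_half)
  have "\<i> * of_real pi * (s - 1) / 2 = \<i> * (of_real pi * s / 2) - \<i> * of_real (pi / 2)"
    by (simp add: field_simps)
  then have 1: "exp (\<i> * of_real pi * (s - 1) / 2) = w / \<i>"
    by (simp only: exp_diff i w_def)
  have "- (\<i> * of_real pi * (s - 1) / 2) = - (\<i> * (of_real pi * s / 2)) + \<i> * of_real (pi / 2)"
    by (simp add: field_simps)
  then have 2: "exp (- (\<i> * of_real pi * (s - 1) / 2)) = v * \<i>"
    by (simp only: exp_add i v_def)
  show "exp (\<i> * of_real pi * (s - 1) / 2) + exp (- (\<i> * of_real pi * (s - 1) / 2)) = 2 * sin (of_real pi * s / 2)"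
    "exp (\<i> * of_real pi * (s - 1) / 2) - exp (- (\<i> * of_real pi * (s - 1) / 2)) = - 2 * \<i> * cos (of_real pi * s / 2)"
    unfolding 1 2 sin_exp_eq cos_exp_eq w_def[symmetric] v_def[symmetric] by (simp_all add: field_simps)
qed

text \<open>The parity of \<open>\<tau>\<close> decides between sine and cosine. What remains is a
  sum of Hurwitz series weighted by Gauss sums, each of norm at most the square root of
  \<open>q\<close>.\<close>

lemma norm_primitive_dirichlet_L_le:
  assumes q: "q > 1" and prim: "primitive_dirichlet_character q \<tau>" and s: "Re s < 0"
  obtains g where "g = sin \<or> g = cos"
    and "norm (dirichlet_L \<tau> s) \<le>
           zeta_real (1 - Re s) * (real q / (2 * pi)) powr (1/2 - Re s) * norm (gamma_factor g s)"
proof -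
  have char: "dirichlet_character q \<tau>" using prim by (simp add: primitive_dirichlet_character_def)
  have ind: "d = q" if "induced_by q \<tau> d \<psi>" for d \<psi>
    using prim that by (auto simp: primitive_dirichlet_character_def)
  have gauss: "norm (gauss_sum q \<tau> m) \<le> sqrt (real q)" for m
    by (rule norm_gauss_sum_le[OF char]) (rule ind)
  let ?R = "{1..<int q}" and ?a = "\<lambda>r. real_of_int r / real q"
  let ?G = "gauss_sum q \<tau>" and ?H = "\<lambda>a. hurwitz_series a (1 - s)"
  define E where "E = exp (\<i> * of_real pi * (s - 1) / 2)"
  define E' where "E' = exp (- (\<i> * of_real pi * (s - 1) / 2))"
  define P where "P = exp ((s - 1) * of_real (ln (2 * pi)))"
  define S where "S = (\<Sum>r\<in>?R. ?G r * ?H (?a r))"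
  define x where "x = 1 - Re s"
  have x: "x > 1" using s by (simp add: x_def)
  have q0: "real q > 0" using q by simp
  have S1: "(\<Sum>r\<in>?R. ?G (- r) * ?H (?a r)) = \<tau> (-1) * S"
    unfolding S_def sum_distrib_left by (simp add: gauss_sum_uminus[OF char] mult.assoc)
  \<comment> \<open>The reflection of \<open>r\<close> to \<open>q - r\<close> exchanges the two
    Hurwitz series, so both halves reduce to the same \<open>S\<close> up to the sign
    \<open>\<tau> (-1)\<close>.\<close>
  have S2: "(\<Sum>r\<in>?R. ?G (- r) * ?H (1 - ?a r)) = S"
    unfolding S_def
  proof (rule sum.reindex_bij_witness[of _ "\<lambda>r. int q - r" "\<lambda>r. int q - r"])
    fix r assume "r \<in> ?R"
    have "?G (int q - r) = ?G (- r)" using gauss_sum_plus_modulus[OF char, of "- r"] by simp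
    moreover have "?a (int q - r) = 1 - ?a r" using q by (simp add: field_simps)
    ultimately show "?G (int q - r) * ?H (?a (int q - r)) = ?G (- r) * ?H (1 - ?a r)" by simp
  qed auto
  have "dirichlet_L \<tau> s = (\<Sum>r\<in>?R. ?G (- r) * (Gamma (1 - s) * P * (E' * ?H (?a r) + E * ?H (1 - ?a r)))) / of_nat q"
    unfolding primitive_dirichlet_L_eq[OF assms] periodic_zeta_left_def E_def E'_def P_def ..
  also have "(\<Sum>r\<in>?R. ?G (- r) * (Gamma (1 - s) * P * (E' * ?H (?a r) + E * ?H (1 - ?a r)))) =
      Gamma (1 - s) * P * (E' * (\<Sum>r\<in>?R. ?G (- r) * ?H (?a r)) + E * (\<Sum>r\<in>?R. ?G (- r) * ?H (1 - ?a r)))"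
    by (simp add: sum_distrib_left sum.distrib algebra_simps)
  also have "\<dots> = Gamma (1 - s) * P * (E + \<tau> (-1) * E') * S"
    unfolding S1 S2 by (simp add: algebra_simps)
  finally have L: "dirichlet_L \<tau> s = Gamma (1 - s) * P * (E + \<tau> (-1) * E') * S / of_nat q" .
  have "(\<tau> (-1) - 1) * (\<tau> (-1) + 1) = 0"
    using char_neg_1_square[OF char] by (simp add: algebra_simps)
  then have "\<tau> (-1) = 1 \<or> \<tau> (-1) = -1" by (simp add: eq_neg_iff_add_eq_0)
  then obtain g where g: "g = sin \<or> g = cos" "norm (E + \<tau> (-1) * E') = 2 * norm (g (of_real pi * s / 2))"
  proof
    assume "\<tau> (-1) = 1"
    then show ?thesis using exp_root_combination(1)[of s]
      by (intro that[of sin]) (auto simp: E_def E'_def norm_mult)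
  next
    assume "\<tau> (-1) = -1"
    then show ?thesis using exp_root_combination(2)[of s]
      by (intro that[of cos]) (auto simp: E_def E'_def norm_mult)
  qed
  have nP: "norm P = (2 * pi) powr (- x)"
    by (simp add: P_def x_def powr_def)
  have "norm S \<le> (\<Sum>r\<in>?R. sqrt (real q) * (\<Sum>k. exp (- x * ln (real k + ?a r))))"
    unfolding S_def
  proof (rule sum_norm_le)
    fix r assume r: "r \<in> ?R"
    have "norm (?H (?a r)) \<le> (\<Sum>k. exp (- x * ln (real k + ?a r)))"
      using norm_hurwitz_series_le[of "?a r" "1 - s"] r s q by (simp add: x_def)
    then show "norm (?G r * ?H (?a r)) \<le> sqrt (real q) * (\<Sum>k. exp (- x * ln (real k + ?a r)))"
      unfolding norm_mult by (intro mult_mono gauss) auto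
  qed
  also have "\<dots> = sqrt (real q) * (\<Sum>r\<in>{1..<q}. \<Sum>k. exp (- x * ln (real k + real r / real q)))"
    unfolding sum_distrib_left
    by (rule sum.reindex_bij_witness[of _ int nat]) auto
  also have "\<dots> \<le> sqrt (real q) * (real q powr x * zeta_real x)"
    using sum_hurwitz_le_zeta[of q x] x q by (intro mult_left_mono) auto
  finally have nS: "norm S \<le> sqrt (real q) * (real q powr x * zeta_real x)" .
  have "norm (gamma_factor g s) = sqrt (2 / pi) * (norm (Gamma (1 - s)) * norm (g (of_real pi * s / 2)))"
    by (simp add: gamma_factor_def norm_mult)
  then have gf: "norm (Gamma (1 - s)) * norm (g (of_real pi * s / 2)) = sqrt (pi / 2) * norm (gamma_factor g s)"
    by (simp add: real_sqrt_divide)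
  have c1: "2 * sqrt (pi / 2) = (2 * pi) powr (1/2)"
    by (simp add: powr_half_sqrt real_sqrt_divide real_sqrt_mult field_simps)
  have c2: "sqrt (real q) = real q powr (1/2)" by (simp add: powr_half_sqrt)
  have c3: "(2 * pi) powr (1/2) * (2 * pi) powr (- x) = (2 * pi) powr (- (x - 1/2))"
    by (simp flip: powr_add)
  \<comment> \<open>The exponents of \<open>q\<close>: \<open>1/2\<close> from the Gauss sums,
    \<open>x\<close> from the Hurwitz series, \<open>-1\<close> from the Fourier inversion.\<close>
  have "1/2 + x + -1 = x - 1/2" by simp
  then have c4: "real q powr (1/2) * real q powr x * real q powr (-1) = real q powr (x - 1/2)"
    by (simp only: powr_add[symmetric])
  have "norm (dirichlet_L \<tau> s) = (norm (Gamma (1 - s)) * norm (g (of_real pi * s / 2))) * 2 * (2 * pi) powr (- x) * norm S / real q"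
    unfolding L by (simp add: norm_mult norm_divide g(2) nP)
  also have "\<dots> = norm (gamma_factor g s) * (2 * sqrt (pi / 2)) * (2 * pi) powr (- x) * norm S / real q"
    unfolding gf by simp
  also have "\<dots> \<le> norm (gamma_factor g s) * (2 * sqrt (pi / 2)) * (2 * pi) powr (- x) *
       (sqrt (real q) * (real q powr x * zeta_real x)) / real q"
    using nS by (intro divide_right_mono mult_left_mono) auto
  also have "\<dots> = zeta_real x * ((2 * pi) powr (1/2) * (2 * pi) powr (- x)) *
       (real q powr (1/2) * real q powr x * real q powr (-1)) * norm (gamma_factor g s)"
    unfolding c1 c2 using q by (simp add: powr_minus field_simps)
  also have "\<dots> = zeta_real x * (2 * pi) powr (- (x - 1/2)) * real q powr (x - 1/2) * norm (gamma_factor g s)"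
    by (simp only: c3 c4)
  also have "\<dots> = zeta_real x * (real q / (2 * pi)) powr (x - 1/2) * norm (gamma_factor g s)"
  proof -
    have "(real q / (2 * pi)) powr (x - 1/2) = real q powr (x - 1/2) / (2 * pi) powr (x - 1/2)"
      by (rule powr_divide)
    also have "\<dots> = (2 * pi) powr (- (x - 1/2)) * real q powr (x - 1/2)"
      unfolding powr_minus divide_inverse by (rule mult.commute)
    finally show ?thesis by (simp only: mult.assoc)
  qed
  also have "x - 1/2 = 1/2 - Re s" by (simp add: x_def)
  finally show ?thesis unfolding x_def by (rule that[OF g(1)])
qed

theorem theorem5p7:
  fixes \<tau> :: "int \<Rightarrow> complex" and q :: nat and s :: complex and \<sigma> t :: real
  assumes "q > 1"
    and "primitive_dirichlet_character q \<tau>"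
    and "s = of_real \<sigma> + \<i> * of_real t"
    and "\<sigma> < 0"
  shows "norm (dirichlet_L \<tau> s)
    \<le> zeta_real (1 - \<sigma>) * (real q / (2 * pi)) powr (1/2 - \<sigma>)
      * norm (s - of_int (nearest_int \<sigma>) + 1) powr (1/2 - \<sigma> + of_int (nearest_int \<sigma>))
      * (\<Prod>j\<in>{1..- nearest_int \<sigma>}. norm (s + of_int j - 1))"
proof -
  have \<sigma>: "Re s = \<sigma>" "Re s < 0" using assms by auto
  obtain g where g: "g = sin \<or> g = cos"
    and L: "norm (dirichlet_L \<tau> s) \<le>
              zeta_real (1 - \<sigma>) * (real q / (2 * pi)) powr (1/2 - \<sigma>) * norm (gamma_factor g s)"
    using norm_primitive_dirichlet_L_le[OF assms(1,2) \<sigma>(2)] unfolding \<sigma>(1) by blast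
  \<comment> \<open>The number of unit shifts. For negative \<open>\<sigma>\<close>, ties towards 0
    are ties upwards, so \<open>\<sigma> + n\<close> lies between \<open>-1/2\<close> (included) and
    \<open>1/2\<close> (excluded), the base strip.\<close>
  define n where "n = nat (- nearest_int \<sigma>)"
  have near: "nearest_int \<sigma> = \<lfloor>\<sigma> + 1/2\<rfloor>" using assms(4) by (simp add: nearest_int_eq)
  then have "nearest_int \<sigma> \<le> 0" using assms(4) by linarith
  then have n: "nearest_int \<sigma> = - int n" by (simp add: n_def)
  have "-1/2 - real n \<le> Re s" "Re s \<le> 1/2 - real n"
    using near unfolding n \<sigma>(1) by linarith+
  from gamma_factor_bound[OF g this]
  have "norm (gamma_factor g s) \<le>
     norm (s + of_nat n + 1) powr (1/2 - \<sigma> - real n) * (\<Prod>j<n. norm (s + of_nat j))"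
    unfolding \<sigma>(1) .
  also have "(\<Prod>j<n. norm (s + of_nat j)) = (\<Prod>j\<in>{1..- nearest_int \<sigma>}. norm (s + of_int j - 1))"
    by (rule prod.reindex_bij_witness[of _ "\<lambda>j. nat (j - 1)" "\<lambda>j. int j + 1"]) (auto simp: n)
  finally have G: "norm (gamma_factor g s) \<le>
     norm (s - of_int (nearest_int \<sigma>) + 1) powr (1/2 - \<sigma> + of_int (nearest_int \<sigma>)) *
     (\<Prod>j\<in>{1..- nearest_int \<sigma>}. norm (s + of_int j - 1))"
    by (simp add: n)
  have "zeta_real (1 - \<sigma>) \<ge> 0"
  proof (cases "summable (\<lambda>n. 1 / real (Suc n) powr (1 - \<sigma>))")
    case True
    then show ?thesis unfolding zeta_real_def by (intro suminf_nonneg) auto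
  next
    case False
    have "summable (\<lambda>n. 1 / real n powr (1 - \<sigma>))"
      using assms(4) by (simp add: summable_real_powr_iff divide_inverse flip: powr_minus)
    with False show ?thesis by (subst (asm) summable_Suc_iff[symmetric]) blast
  qed
  then have "zeta_real (1 - \<sigma>) * (real q / (2 * pi)) powr (1/2 - \<sigma>) * norm (gamma_factor g s) \<le>
     zeta_real (1 - \<sigma>) * (real q / (2 * pi)) powr (1/2 - \<sigma>) *
     (norm (s - of_int (nearest_int \<sigma>) + 1) powr (1/2 - \<sigma> + of_int (nearest_int \<sigma>)) *
     (\<Prod>j\<in>{1..- nearest_int \<sigma>}. norm (s + of_int j - 1)))"
    using G by (intro mult_left_mono) auto
  with L show ?thesis by (simp only: mult.assoc)
qed

end
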